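(* Let $\mathbb{K}\in\{\mathbb{R},\mathbb{C}\}$ and let $\ell,n,m\in\mathbb{N}^*$. Then the following equivalences hold: (i) $S^H_{\text{behavioural stabilizable}}$ is relative generic in $\Sigma^H_{\ell,n,m}$ $\iff$ $\ell\neq n+m$; (ii) $S^H_{\text{completely stabilizable}}$ is relative generic in $\Sigma^H_{\ell,n,m}$ $\iff$ $\ell<n+m$; (iii) $S^H_{\text{strongly stabilizable}}$ is relative generic in $\Sigma^H_{\ell,n,m}$ $\iff$ $\ell<n+m$. Likewise, with reference set $\Sigma^{sdH}_{\ell,n,m}$: $S^{sdH}_{\text{behavioural stabilizable}}$ is relative generic in $\Sigma^{sdH}_{\ell,n,m}$ $\iff$ $\ell\neq n+m$; $S^{sdH}_{\text{completely stabilizable}}$ is relative generic in $\Sigma^{sdH}_{\ell,n,m}$ $\iff$ $\ell<n+m$; $S^{sdH}_{\text{strongly stabilizable}}$ is relative generic in $\Sigma^{sdH}_{\ell,n,m}$ $\iff$ $\ell<n+m$. Moreover, if $\ell>n+m$, then $(S^{\star}_{\text{completely stabilizable}})^c$ and $(S^{\star}_{\text{strongly stabilizable}})^c$ are relative generic in $\Sigma^{\star}_{\ell,n,m}$, where $\star$ stands for either $H$ or $dH$.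
   Context: $\mathbb{N}^*=\{1,2,\dots\}$; $\mathbb{K}$ is $\mathbb{R}$ or $\mathbb{C}$; $M^*$ is the conjugate transpose (transpose if $\mathbb{K}=\mathbb{R}$); $M\ge 0$ ($M>0$) means Hermitian/symmetric positive semidefinite (definite); $\overline{\mathbb{C}}_+=\{\lambda\in\mathbb{C}:\mathrm{Re}\,\lambda\ge0\}$. Port-Hamiltonian descriptor systems are $\frac{d}{dt}Ex=(J-R)Qx+Bu$. Reference sets: $\Sigma^{H}_{\ell,n,m}=\{(E,J,Q,B)\in\mathbb{K}^{\ell\times n}\times\mathbb{K}^{\ell\times\ell}\times\mathbb{K}^{\ell\times n}\times\mathbb{K}^{\ell\times m} : J=-J^*,\ E^*Q=Q^*E\ge0\}$; $\Sigma^{sdH}_{\ell,n,m}=\{(E,J,R,Q,B)\in\mathbb{K}^{\ell\times n}\times\mathbb{K}^{\ell\times\ell}\times\mathbb{K}^{\ell\times\ell}\times\mathbb{K}^{\ell\times n}\times\mathbb{K}^{\ell\times m} : J=-J^*,\ R=R^*\ge0,\ E^*Q=Q^*E\ge0\}$; $\Sigma^{dH}_{\ell,n,m}$ is defined as $\Sigma^{sdH}_{\ell,n,m}$ but with $R=R^*>0$. Stabilizability of $(E,A,B)\in\Sigma_{\ell,n,m}:=\mathbb{K}^{\ell\times n}\times\mathbb{K}^{\ell\times n}\times\mathbb{K}^{\ell\times m}$, i.e. of $\frac{d}{dt}Ex=Ax+Bu$ ($\mathrm{rk}$ without subscript is the rank of a constant matrix; $\mathrm{rk}_{\mathbb{K}(x)}$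 is the rank over the field of rational functions): - completely stabilizable: for all $\lambda\in\overline{\mathbb{C}}_+$, $\mathrm{rk}[E,A,B]=\mathrm{rk}[E,B]=\mathrm{rk}_{\mathbb{C}}[\lambda E-A,B]$; - strongly stabilizable: for all $\lambda\in\overline{\mathbb{C}}_+$ and all $Z\in\mathbb{K}^{n\times(n-\mathrm{rk}E)}$ with $\mathrm{im}\,Z=\ker E$, $\mathrm{rk}[E,A,B]=\mathrm{rk}[E,AZ,B]=\mathrm{rk}_{\mathbb{C}}[\lambda E-A,B]$; - behavioural stabilizable: for all $\lambda\in\overline{\mathbb{C}}_+$, $\mathrm{rk}_{\mathbb{K}(x)}[xE-A,B]=\mathrm{rk}_{\mathbb{C}}[\lambda E-A,B]$. $S_{\text{stabilizable}}\subseteq\Sigma_{\ell,n,m}$ is the set of triples with the respective property, and $S^H_{\text{stabilizable}}=\{(E,J,Q,B)\in\Sigma^H_{\ell,n,m}:(E,JQ,B)\in S_{\text{stabilizable}}\}$, $S^{dH}_{\text{stabilizable}}=\{(E,J,R,Q,B)\in\Sigma^{dH}_{\ell,n,m}:(E,(J-R)Q,B)\in S_{\text{stabilizable}}\}$, and $S^{sdH}_{\text{stabilizable}}$ likewise with $\Sigma^{sdH}_{\ell,n,m}$. Relative genericity: an algebraic set in $\mathbb{R}^N$ is the common zero set of finitely many real polynomials in $N$ indeterminates. For $S,V\subseteq\mathbb{R}^N$, $S$ is relative generic in $V$ iff there is an algebraic set $\mathbb{V}\subseteq\mathbb{R}^N$ with $S^c\cap V\subseteq\mathbb{V}\cap V$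 and $\mathbb{V}^c\cap V$ Euclidean dense in $V$. Spaces of (tuples of) matrices over $\mathbb{K}$ are identified with some $\mathbb{R}^N$ by a real vector space isomorphism (in particular $\mathbb{C}^N\cong\mathbb{R}^{2N}$); the notion does not depend on the isomorphism. Complements are taken in the ambient matrix space. *)

theory Defs
  imports "HOL-Analysis.Analysis" "HOL-Computational_Algebra.Polynomial_Factorial"
begin

section \<open>The field of real or complex numbers\<close>

text \<open>
  The embedding \<open>to_complex\<close> is an isometric homomorphism of real algebras whose range is
  either the reals or all complex numbers, so the only models, up to isomorphism, are the two
  instances below.  The inner product, hence the Euclidean topology, is determined by the norm.
\<close>

class real_or_complex = real_normed_field + euclidean_space +
  fixes to_complex :: "'a \<Rightarrow> complex"
    and kconj :: "'a \<Rightarrow> 'a"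
  assumes to_complex_add: "to_complex (x + y) = to_complex x + to_complex y"
    and to_complex_mult: "to_complex (x * y) = to_complex x * to_complex y"
    and to_complex_scaleR: "to_complex (scaleR r x) = scaleR r (to_complex x)"
    and norm_to_complex: "norm (to_complex x) = norm x"
    and to_complex_kconj: "to_complex (kconj x) = cnj (to_complex x)"
    and range_to_complex: "range to_complex = \<real> \<or> range to_complex = UNIV"

instantiation real :: real_or_complex
begin

definition to_complex_real :: "real \<Rightarrow> complex" where
  "to_complex_real = complex_of_real"

definition kconj_real :: "real \<Rightarrow> real" where
  "kconj_real x = x"

instance
  by standard (auto simp: to_complex_real_def kconj_real_def Reals_def scaleR_conv_of_real)

end

instantiation complex :: real_or_complex
begin

definition to_complex_complex :: "complex \<Rightarrow> complex" where
  "to_complex_complex z = z"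

definition kconj_complex :: "complex \<Rightarrow> complex" where
  "kconj_complex = cnj"

instance
  by standard (auto simp: to_complex_complex_def kconj_complex_def)

end


section \<open>Matrices\<close>

text \<open>Number of rows first.\<close>

type_synonym ('k, 'l, 'n) matrix = "'k ^ 'n ^ 'l"

definition adj :: "('k::real_or_complex, 'l::finite, 'n::finite) matrix \<Rightarrow> ('k, 'n, 'l) matrix" where
  "adj M = (\<chi> i j. kconj (M $ j $ i))"

definition hdot :: "'k::real_or_complex ^ 'n::finite \<Rightarrow> 'k ^ 'n \<Rightarrow> 'k" where
  "hdot x y = (\<Sum>i\<in>UNIV. kconj (x $ i) * y $ i)"

text \<open>For \<open>M = adj M\<close> the value \<open>hdot x (M *v x)\<close> is real; \<open>Re\<close> only changes its type.\<close>

definition psd :: "('k::real_or_complex, 'n::finite, 'n) matrix \<Rightarrow> bool" where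
  "psd M \<longleftrightarrow> M = adj M \<and> (\<forall>x. Re (to_complex (hdot x (M *v x))) \<ge> 0)"

definition pd :: "('k::real_or_complex, 'n::finite, 'n) matrix \<Rightarrow> bool" where
  "pd M \<longleftrightarrow> M = adj M \<and> (\<forall>x. x \<noteq> 0 \<longrightarrow> Re (to_complex (hdot x (M *v x))) > 0)"

definition hcat :: "('k, 'l::finite, 'n::finite) matrix \<Rightarrow> ('k, 'l, 'm::finite) matrix
    \<Rightarrow> ('k, 'l, 'n + 'm) matrix" where
  "hcat A B = (\<chi> i j. case j of Inl p \<Rightarrow> A $ i $ p | Inr q \<Rightarrow> B $ i $ q)"

definition pencil :: "'f::field \<Rightarrow> ('f, 'l::finite, 'n::finite) matrix \<Rightarrow> ('f, 'l, 'n) matrix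
    \<Rightarrow> ('f, 'l, 'n) matrix" where
  "pencil s E A = (\<chi> i j. s * E $ i $ j - A $ i $ j)"

text \<open>Rank of \<open>[\<lambda>E - A, B]\<close> over the complex numbers.\<close>

definition rank_pencil_at :: "complex \<Rightarrow> ('k::real_or_complex, 'l::finite, 'n::finite) matrix
    \<Rightarrow> ('k, 'l, 'n) matrix \<Rightarrow> ('k, 'l, 'm::finite) matrix \<Rightarrow> nat" where
  "rank_pencil_at z E A B =
    rank (hcat (pencil z (map_matrix to_complex E) (map_matrix to_complex A))
      (map_matrix to_complex B))"

text \<open>Rank of \<open>[xE - A, B]\<close> over the field \<open>'k poly fract\<close> of rational functions.\<close>

definition rank_pencil_fract :: "('k::real_or_complex, 'l::finite, 'n::finite) matrix
    \<Rightarrow> ('k, 'l, 'n) matrix \<Rightarrow> ('k, 'l, 'm::finite) matrix \<Rightarrow> nat" where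
  "rank_pencil_fract E A B =
    (let C = (\<lambda>a. to_fract [:a:])
     in rank (hcat (pencil (to_fract [:0, 1:]) (map_matrix C E) (map_matrix C A))
          (map_matrix C B)))"


section \<open>Stabilizability\<close>

type_synonym ('k, 'l, 'n, 'm) descriptor =
  "('k, 'l, 'n) matrix \<times> ('k, 'l, 'n) matrix \<times> ('k, 'l, 'm) matrix"

definition closed_rhp :: "complex set" where
  "closed_rhp = {z. Re z \<ge> 0}"

definition completely_stabilizable ::
    "('k::real_or_complex, 'l::finite, 'n::finite, 'm::finite) descriptor set" where
  "completely_stabilizable = {(E, A, B). \<forall>z\<in>closed_rhp.
     rank (hcat E (hcat A B)) = rank (hcat E B) \<and>
     rank (hcat E B) = rank_pencil_at z E A B}"

text \<open>
  The matrix \<open>Z\<close> has \<open>n - rk E\<close> columns, a number that depends on \<open>E\<close>, so it cannot be an index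
  type.  Therefore \<open>Z\<close> is given as the list of its columns: its image is their span, and the rank
  of \<open>[E, AZ, B]\<close> is the dimension of the span of all columns.
\<close>

definition strongly_stabilizable ::
    "('k::real_or_complex, 'l::finite, 'n::finite, 'm::finite) descriptor set" where
  "strongly_stabilizable = {(E, A, B). \<forall>z\<in>closed_rhp. \<forall>Z :: ('k ^ 'n) list.
     length Z = CARD('n) - rank E \<and> vec.span (set Z) = {v. E *v v = 0} \<longrightarrow>
     rank (hcat E (hcat A B)) = vec.dim (columns E \<union> set (map ((*v) A) Z) \<union> columns B) \<and>
     vec.dim (columns E \<union> set (map ((*v) A) Z) \<union> columns B) = rank_pencil_at z E A B}"

definition behavioural_stabilizable ::
    "('k::real_or_complex, 'l::finite, 'n::finite, 'm::finite) descriptor set" where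
  "behavioural_stabilizable = {(E, A, B). \<forall>z\<in>closed_rhp.
     rank_pencil_fract E A B = rank_pencil_at z E A B}"


section \<open>Port-Hamiltonian reference sets\<close>

type_synonym ('k, 'l, 'n, 'm) ham =
  "('k, 'l, 'n) matrix \<times> ('k, 'l, 'l) matrix \<times> ('k, 'l, 'n) matrix \<times> ('k, 'l, 'm) matrix"

type_synonym ('k, 'l, 'n, 'm) diss_ham =
  "('k, 'l, 'n) matrix \<times> ('k, 'l, 'l) matrix \<times> ('k, 'l, 'l) matrix \<times> ('k, 'l, 'n) matrix
    \<times> ('k, 'l, 'm) matrix"

definition Sigma_H :: "('k::real_or_complex, 'l::finite, 'n::finite, 'm::finite) ham set" where
  "Sigma_H = {(E, J, Q, B). J = - adj J \<and> adj E ** Q = adj Q ** E \<and> psd (adj E ** Q)}"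

definition Sigma_sdH ::
    "('k::real_or_complex, 'l::finite, 'n::finite, 'm::finite) diss_ham set" where
  "Sigma_sdH = {(E, J, R, Q, B). J = - adj J \<and> R = adj R \<and> psd R \<and>
     adj E ** Q = adj Q ** E \<and> psd (adj E ** Q)}"

definition Sigma_dH ::
    "('k::real_or_complex, 'l::finite, 'n::finite, 'm::finite) diss_ham set" where
  "Sigma_dH = {(E, J, R, Q, B). J = - adj J \<and> R = adj R \<and> pd R \<and>
     adj E ** Q = adj Q ** E \<and> psd (adj E ** Q)}"

definition S_H :: "('k::real_or_complex, 'l::finite, 'n::finite, 'm::finite) descriptor set
    \<Rightarrow> ('k, 'l, 'n, 'm) ham set" where
  "S_H S = {(E, J, Q, B). (E, J, Q, B) \<in> Sigma_H \<and> (E, J ** Q, B) \<in> S}"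

definition S_sdH :: "('k::real_or_complex, 'l::finite, 'n::finite, 'm::finite) descriptor set
    \<Rightarrow> ('k, 'l, 'n, 'm) diss_ham set" where
  "S_sdH S = {(E, J, R, Q, B). (E, J, R, Q, B) \<in> Sigma_sdH \<and> (E, (J - R) ** Q, B) \<in> S}"

definition S_dH :: "('k::real_or_complex, 'l::finite, 'n::finite, 'm::finite) descriptor set
    \<Rightarrow> ('k, 'l, 'n, 'm) diss_ham set" where
  "S_dH S = {(E, J, R, Q, B). (E, J, R, Q, B) \<in> Sigma_dH \<and> (E, (J - R) ** Q, B) \<in> S}"


section \<open>Relative genericity\<close>

text \<open>
  On a Euclidean space, \<^const>\<open>real_polynomial_function\<close> is the algebra of functions generated by
  the real-linear functionals and the constants, that is, the real polynomials in the coordinates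
  with respect to any real vector space isomorphism with \<open>\<real>\<^sup>N\<close>.
\<close>

definition algebraic_set :: "'v::euclidean_space set \<Rightarrow> bool" where
  "algebraic_set W \<longleftrightarrow>
    (\<exists>P. finite P \<and> (\<forall>p\<in>P. real_polynomial_function p) \<and> W = {x. \<forall>p\<in>P. p x = 0})"

definition relative_generic :: "'v::euclidean_space set \<Rightarrow> 'v set \<Rightarrow> bool" where
  "relative_generic S V \<longleftrightarrow>
    (\<exists>W. algebraic_set W \<and> - S \<inter> V \<subseteq> W \<inter> V \<and> V \<subseteq> closure (- W \<inter> V))"

end

theory Submission
  imports Defs "HOL-Complex_Analysis.Conformal_Mappings"
begin

text \<open>
  The pairs \<open>(E, S E)\<close> with \<open>S\<close> positive semidefinite are dense in the set of pairs \<open>(E, Q)\<close> with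
  \<open>E\<^sup>* Q = Q\<^sup>* E \<ge> 0\<close>. So each reference set is the closure (within itself) of a polynomial image of a
  convex set, and a polynomial that does not vanish at one point \<open>(E, J, (R,) E, B)\<close> is nonzero on a
  dense subset. For \<open>\<ell> \<noteq> n + m\<close> the full rank of \<open>[zE - A, B]\<close> for all complex \<open>z\<close> follows from the
  injectivity of a block Toeplitz matrix that no longer contains \<open>z\<close>; that is a polynomial
  inequation, satisfied by a path-like skew-symmetric \<open>J\<close>. For \<open>\<ell> = n + m\<close> a simple zero of
  \<open>det [zE - A, B]\<close> at \<open>z = 1\<close> persists under perturbation, whereas each of the three properties makes
  the rank of \<open>[zE - A, B]\<close> constant on the closed right half-plane. For \<open>\<ell> > n + m\<close> the matrix
  \<open>[E, A, B]\<close> generically has rank exceeding \<open>n + m\<close>, which rules out complete and strong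
  stabilizability.
\<close>

section \<open>Hermitian matrices and the real inner product\<close>

text \<open>Two obstacles shape the proof. The constraint on \<open>E\<close> and \<open>Q\<close>
  is neither linear nor visibly irreducible, and on a reducible set a polynomial may vanish on a
  whole piece without vanishing identically. A convex parameter space removes this: a segment joins
  any point to a good one, and only finitely many of its points are bad. The witnesses for
  genericity have \<open>Q = E\<close> because this is the image of \<open>S = 1\<close>; the square
  case needs just one point with an open neighbourhood and is not tied to that form. Secondly, full
  rank at every \<open>z\<close> is not a polynomial condition on the data, as the offending
  \<open>z\<close> varies with them. The recurrence is a sufficient condition without
  \<open>z\<close>, so the witness has to satisfy the recurrence itself. On a path, solving for the
  farther neighbour propagates zeros by one position per time step, provided that a boundary value
  is zero. For \<open>l < n + m\<close> a column of \<open>B\<close> is spent on that boundary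
  position; for \<open>l > n + m\<close> a row is left empty there. With \<open>l = n + m\<close>
  neither arrangement fits.\<close>

lemma to_complex_eq_iff [simp]: "to_complex x = to_complex y \<longleftrightarrow> x = y"
proof
  assume eq: "to_complex x = to_complex y"
  have "to_complex (x - y) + to_complex y = to_complex y"
    using eq by (simp flip: to_complex_add)
  then have "norm (x - y) = 0"
    using norm_to_complex[of "x - y"] by simp
  then show "x = y" by simp
qed simp

lemma to_complex_0 [simp]: "to_complex 0 = 0"
  using norm_to_complex[of 0] by simp

lemma to_complex_1 [simp]: "to_complex (1::'k::real_or_complex) = 1"
proof -
  have "to_complex (1::'k) * to_complex (1::'k) = to_complex (1::'k) * 1"
    using to_complex_mult[of "1::'k" 1] by simp
  moreover have "to_complex (1::'k) \<noteq> 0"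
    using norm_to_complex[of "1::'k"] by auto
  ultimately show ?thesis by simp
qed

lemma to_complex_eq_0_iff [simp]: "to_complex x = 0 \<longleftrightarrow> x = 0"
  using to_complex_eq_iff[of x 0] by simp

lemma to_complex_minus [simp]: "to_complex (- x) = - to_complex x"
  using to_complex_scaleR[of "-1" x] by simp

lemma to_complex_diff [simp]: "to_complex (x - y) = to_complex x - to_complex y"
  using to_complex_add[of x "- y"] by simp

lemma to_complex_sum: "to_complex (sum f A) = (\<Sum>x\<in>A. to_complex (f x))"
  by (induction A rule: infinite_finite_induct) (auto simp: to_complex_add)

lemma to_complex_prod: "to_complex (prod f A) = (\<Prod>x\<in>A. to_complex (f x))"
  by (induction A rule: infinite_finite_induct) (auto simp: to_complex_mult)

lemma bounded_linear_to_complex: "bounded_linear to_complex"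
  by (rule bounded_linear_intro[of _ 1])
     (auto simp: to_complex_add to_complex_scaleR norm_to_complex)

lemma to_complex_det:
  fixes A :: "('k::real_or_complex, 'n::finite, 'n) matrix"
  shows "to_complex (det A) = det (map_matrix to_complex A)"
proof -
  have "to_complex (of_int (sign p) :: 'k) = of_int (sign p)" for p :: "'n \<Rightarrow> 'n"
    by (simp add: sign_def)
  then show ?thesis
    by (simp add: det_def to_complex_sum to_complex_mult to_complex_prod)
qed

text \<open>Polarization: an inner product is determined by its norm, and \<open>to_complex\<close>
  is an additive isometry.\<close>

lemma inner_to_complex: "a \<bullet> b = Re (cnj (to_complex a) * to_complex b)"
proof -
  have "a \<bullet> b = to_complex a \<bullet> to_complex b"
    by (simp add: dot_norm norm_to_complex flip: to_complex_add)
  then show ?thesis by (simp add: inner_complex_def)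
qed

lemma kconj_eq_iff: "kconj x = y \<longleftrightarrow> cnj (to_complex x) = to_complex y"
  by (simp flip: to_complex_kconj)

lemma kconj_simps [simp]:
  "kconj (kconj x) = x" "kconj (x + y) = kconj x + kconj y" "kconj (x * y) = kconj x * kconj y"
  "kconj (scaleR r x) = scaleR r (kconj x)" "kconj 0 = 0" "kconj 1 = 1" "kconj (- x) = - kconj x"
  by (simp_all add: kconj_eq_iff to_complex_kconj to_complex_add to_complex_mult to_complex_scaleR)

lemma kconj_sum: "kconj (sum f A) = (\<Sum>x\<in>A. kconj (f x))"
  by (induction A rule: infinite_finite_induct) auto

lemma inner_mult_kconj: "(a * b) \<bullet> c = b \<bullet> (kconj a * c)"
  by (simp only: inner_to_complex to_complex_mult to_complex_kconj complex_cnj_mult) (simp add: algebra_simps)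

text \<open>Moves definiteness into the real inner product space, where Cauchy-Schwarz and the
  adjoint rule \<open>inner_adj\<close> serve both fields at once.\<close>

lemma Re_hdot: "Re (to_complex (hdot x y)) = x \<bullet> y"
  by (simp add: hdot_def inner_vec_def inner_to_complex to_complex_sum to_complex_mult to_complex_kconj)

lemma psd_iff_inner: "psd M \<longleftrightarrow> M = adj M \<and> (\<forall>x. 0 \<le> x \<bullet> (M *v x))"
  and pd_iff_inner: "pd M \<longleftrightarrow> M = adj M \<and> (\<forall>x. x \<noteq> 0 \<longrightarrow> 0 < x \<bullet> (M *v x))"
  by (simp_all add: psd_def pd_def Re_hdot)

lemma psd_adj: "psd M \<Longrightarrow> adj M = M"
  unfolding psd_iff_inner by (elim conjE, erule sym)

lemma pd_adj: "pd M \<Longrightarrow> adj M = M"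
  unfolding pd_iff_inner by (elim conjE, erule sym)

lemma psd_inner: "psd M \<Longrightarrow> 0 \<le> x \<bullet> (M *v x)"
  unfolding psd_iff_inner by (elim conjE, erule spec)

lemma pd_inner: "pd M \<Longrightarrow> x \<noteq> 0 \<Longrightarrow> 0 < x \<bullet> (M *v x)"
  unfolding pd_iff_inner by blast

lemma psdI: "adj M = M \<Longrightarrow> (\<And>x. 0 \<le> x \<bullet> (M *v x)) \<Longrightarrow> psd M"
  unfolding psd_iff_inner by (intro conjI allI, erule sym)

lemma pdI: "adj M = M \<Longrightarrow> (\<And>x. x \<noteq> 0 \<Longrightarrow> 0 < x \<bullet> (M *v x)) \<Longrightarrow> pd M"
  unfolding pd_iff_inner by (intro conjI allI impI, erule sym)

lemma inner_adj: "(A *v x) \<bullet> y = x \<bullet> (adj A *v y)"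
proof -
  have "(A *v x) \<bullet> y = (\<Sum>i\<in>UNIV. \<Sum>j\<in>UNIV. (A $ i $ j * x $ j) \<bullet> y $ i)"
    by (simp add: inner_vec_def matrix_vector_mult_def inner_sum_left)
  also have "\<dots> = (\<Sum>j\<in>UNIV. \<Sum>i\<in>UNIV. x $ j \<bullet> (kconj (A $ i $ j) * y $ i))"
    by (subst sum.swap) (simp add: inner_mult_kconj)
  also have "\<dots> = x \<bullet> (adj A *v y)"
    by (simp add: inner_vec_def matrix_vector_mult_def inner_sum_right adj_def)
  finally show ?thesis .
qed

lemma adj_adj [simp]: "adj (adj A) = A"
  by (simp add: adj_def vec_eq_iff)

lemma adj_add [simp]: "adj (A + B) = adj A + adj B"
  by (simp add: adj_def vec_eq_iff)

lemma adj_minus [simp]: "adj (- A) = - adj A"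
  by (simp add: adj_def vec_eq_iff)

lemma adj_scaleR [simp]: "adj (r *\<^sub>R A) = r *\<^sub>R adj A"
  by (simp add: adj_def vec_eq_iff)

lemma adj_matrix_mul [simp]: "adj (A ** B) = adj B ** adj A"
  by (simp add: adj_def vec_eq_iff matrix_matrix_mult_def kconj_sum mult.commute)

lemma adj_mat_1 [simp]: "adj (mat 1) = mat 1"
  by (simp add: adj_def vec_eq_iff mat_def)

lemma scaleR_matrix_vector_mul: "(r *\<^sub>R A) *v x = r *\<^sub>R (A *v x)"
  for A :: "('k::real_or_complex, 'l::finite, 'n::finite) matrix"
  by (simp add: vec_eq_iff matrix_vector_mult_def scaleR_sum_right)

lemma scaleR_matrix_mul_left: "(r *\<^sub>R A) ** B = r *\<^sub>R (A ** B)"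
  for A :: "('k::real_or_complex, 'l::finite, 'n::finite) matrix"
  by (simp add: vec_eq_iff matrix_matrix_mult_def scaleR_sum_right)

lemma scaleR_matrix_mul_right: "A ** (r *\<^sub>R B) = r *\<^sub>R (A ** B)"
  for A :: "('k::real_or_complex, 'l::finite, 'n::finite) matrix"
  by (simp add: vec_eq_iff matrix_matrix_mult_def scaleR_sum_right)

lemmas scaleR_matrix_simps = scaleR_matrix_vector_mul scaleR_matrix_mul_left scaleR_matrix_mul_right

lemma matrix_diff_ldistrib: "A ** (B - C) = A ** B - A ** C"
  for A :: "'a::ring_1 ^ 'n::finite ^ 'm::finite"
  by (simp add: vec_eq_iff matrix_matrix_mult_def right_diff_distrib sum_subtractf)

section \<open>The cones of semidefinite and definite matrices\<close>

lemma psd_congruence: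
  assumes "psd G" shows "psd (adj C ** G ** C)"
proof (rule psdI)
  show "adj (adj C ** G ** C) = adj C ** G ** C"
    by (simp add: psd_adj[OF assms] matrix_mul_assoc)
  have "0 \<le> (C *v x) \<bullet> (G *v (C *v x))" for x
    by (rule psd_inner[OF assms])
  then show "0 \<le> x \<bullet> ((adj C ** G ** C) *v x)" for x
    by (simp add: inner_adj matrix_vector_mul_assoc matrix_mul_assoc)
qed

lemma pd_mat_1: "pd (mat 1 :: ('k::real_or_complex, 'n::finite, 'n) matrix)"
  by (rule pdI) simp_all

lemma pd_imp_psd: "pd M \<Longrightarrow> psd M"
proof (rule psdI)
  assume M: "pd M"
  show "0 \<le> x \<bullet> (M *v x)" for x
    by (cases "x = 0") (auto intro: less_imp_le pd_inner[OF M])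
qed (rule pd_adj)

lemma psd_0: "psd 0"
  by (rule psdI) (simp_all add: adj_def vec_eq_iff)

text \<open>The inverse is itself a congruence of \<open>K\<close>, namely
  \<open>G = adj G ** K ** G\<close>, and is therefore semidefinite without any spectral
  theory.\<close>

lemma pd_inverse:
  fixes K :: "('k::real_or_complex, 'n::finite, 'n) matrix"
  assumes "pd K"
  obtains G where "K ** G = mat 1" "G ** K = mat 1" "psd G"
proof -
  have "x = 0" if "K *v x = 0" for x
    using pd_inner[OF assms, of x] that by auto
  then obtain G where GK: "G ** K = mat 1"
    using matrix_left_invertible_ker[of K] by blast
  then have KG: "K ** G = mat 1"
    by (simp add: matrix_left_right_inverse)
  have "adj G = adj G ** (adj K ** G)"
    by (simp add: KG pd_adj[OF assms])
  also have "\<dots> = adj (K ** G) ** G"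
    by (simp add: matrix_mul_assoc)
  finally have G: "adj G = G" by (simp add: KG)
  have "psd (adj G ** K ** G)"
    using psd_congruence[OF pd_imp_psd[OF assms]] .
  then have "psd G" by (simp add: G GK)
  with KG GK that show ?thesis by blast
qed

lemma convex_psd: "convex {M. psd M}"
  by (rule convexI) (auto intro!: psdI simp: psd_adj psd_inner matrix_vector_mult_add_rdistrib
      scaleR_matrix_simps inner_add_right)

lemma convex_pd: "convex {M. pd M}"
proof (rule convexI)
  fix M N :: "('a, 'b, 'b) matrix" and u v :: real
  assume *: "M \<in> {M. pd M}" "N \<in> {M. pd M}" "0 \<le> u" "0 \<le> v" "u + v = 1"
  have "0 < x \<bullet> ((u *\<^sub>R M + v *\<^sub>R N) *v x)" if "x \<noteq> 0" for x
  proof -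
    have "0 < x \<bullet> (M *v x)" "0 < x \<bullet> (N *v x)"
      using * that by (auto simp: pd_inner)
    then have "0 < u * (x \<bullet> (M *v x)) + v * (x \<bullet> (N *v x))"
      using * by (smt (verit) mult_nonneg_nonneg mult_pos_pos less_eq_real_def)
    then show ?thesis
      by (simp add: matrix_vector_mult_add_rdistrib scaleR_matrix_simps inner_add_right)
  qed
  then show "u *\<^sub>R M + v *\<^sub>R N \<in> {M. pd M}"
    using * by (auto intro!: pdI simp: pd_adj)
qed

lemma skew_iff: "J = - adj J \<longleftrightarrow> adj J = - J"
  by (rule equation_minus_iff)

lemma convex_skew: "convex {J. J = - adj J}"
proof (rule convexI)
  fix M N :: "('a, 'b, 'b) matrix" and u v :: real
  assume "M \<in> {J. J = - adj J}" and "N \<in> {J. J = - adj J}"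
  then have "adj M = - M" "adj N = - N"
    by (simp_all only: mem_Collect_eq flip: skew_iff)
  then show "u *\<^sub>R M + v *\<^sub>R N \<in> {J. J = - adj J}"
    unfolding mem_Collect_eq by (intro skew_iff[THEN iffD2]) simp
qed

text \<open>
  With \<open>E' = E + \<epsilon> Q\<close> one has \<open>Q\<^sup>* E' = E\<^sup>* Q + \<epsilon> Q\<^sup>* Q\<close>, which controls \<open>Q\<^sup>* Q\<close>; the matrix
  \<open>S = Q (Q\<^sup>* E' + \<epsilon>\<^sup>3)\<^sup>-\<^sup>1 Q\<^sup>*\<close> then nearly satisfies \<open>S E' = Q\<close>.
\<close>

lemma psd_factor_approx:
  fixes E Q :: "('k::real_or_complex, 'l::finite, 'n::finite) matrix"
  assumes herm: "adj E ** Q = adj Q ** E" and psd: "psd (adj E ** Q)" and e: "0 < \<epsilon>"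
  obtains S where "psd S" "\<And>x. norm ((Q - S ** (E + \<epsilon> *\<^sub>R Q)) *v x) \<le> \<epsilon> * norm x"
proof -
  define H where "H = adj Q ** (E + \<epsilon> *\<^sub>R Q)"
  \<comment> \<open>The estimates below bound the residual by
    \<open>sqrt (d / \<epsilon>) * norm x\<close>; the cube turns this into
    \<open>\<epsilon> * norm x\<close>.\<close>
  define d where "d = \<epsilon> ^ 3"
  define K where "K = H + d *\<^sub>R mat 1"
  have d: "0 < d" using e by (simp add: d_def)
  have quad: "y \<bullet> (K *v y) = y \<bullet> ((adj E ** Q) *v y) + \<epsilon> * (norm (Q *v y))\<^sup>2 + d * (norm y)\<^sup>2" for y
  proof -
    have "(Q *v y) \<bullet> (Q *v y) = y \<bullet> ((adj Q ** Q) *v y)"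
      by (simp add: inner_adj matrix_vector_mul_assoc)
    then show ?thesis
      by (simp add: K_def H_def herm matrix_add_ldistrib matrix_vector_mult_add_rdistrib
          scaleR_matrix_simps inner_add_right power2_norm_eq_inner)
  qed
  have quad_ge: "\<epsilon> * (norm (Q *v y))\<^sup>2 + d * (norm y)\<^sup>2 \<le> y \<bullet> (K *v y)" for y
    using psd_inner[OF psd] by (simp add: quad)
  have "pd K"
  proof (rule pdI)
    show "adj K = K"
      by (simp add: K_def H_def matrix_add_ldistrib scaleR_matrix_simps herm[symmetric])
    fix x :: "'k ^ 'n" assume "x \<noteq> 0"
    then have "0 < d * (norm x)\<^sup>2" using d by simp
    also have "\<dots> \<le> \<epsilon> * (norm (Q *v x))\<^sup>2 + d * (norm x)\<^sup>2" using e by simp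
    finally show "0 < x \<bullet> (K *v x)" using quad_ge[of x] by linarith
  qed
  then obtain G where G: "K ** G = mat 1" "G ** K = mat 1" "psd G"
    using pd_inverse by blast
  define S where "S = Q ** G ** adj Q"
  have "psd S"
    using psd_congruence[OF G(3), of "adj Q"] by (simp add: S_def)
  moreover have "norm ((Q - S ** (E + \<epsilon> *\<^sub>R Q)) *v x) \<le> \<epsilon> * norm x" for x
  proof -
    define y where "y = G *v x"
    have Ky: "K *v y = x" by (simp add: y_def matrix_vector_mul_assoc G)
    \<comment> \<open>Without the shift by \<open>d\<close>, \<open>G\<close> would invert
      \<open>H\<close> and \<open>S\<close> would reproduce \<open>Q\<close> exactly; the shift
      leaves the residual \<open>d\<close> times \<open>Q ** G\<close>.\<close>
    have "S ** (E + \<epsilon> *\<^sub>R Q) = Q ** (G ** H)"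
      by (simp add: S_def H_def matrix_mul_assoc)
    also have "G ** H = G ** K - d *\<^sub>R G"
      by (simp add: K_def matrix_add_ldistrib scaleR_matrix_simps)
    finally have "Q - S ** (E + \<epsilon> *\<^sub>R Q) = Q - Q ** (mat 1 - d *\<^sub>R G)"
      by (simp add: G)
    also have "\<dots> = d *\<^sub>R (Q ** G)"
      by (simp add: matrix_diff_ldistrib scaleR_matrix_simps)
    finally have eq: "(Q - S ** (E + \<epsilon> *\<^sub>R Q)) *v x = d *\<^sub>R (Q *v y)"
      by (simp add: scaleR_matrix_simps y_def matrix_vector_mul_assoc)
    have le: "\<epsilon> * (norm (Q *v y))\<^sup>2 + d * (norm y)\<^sup>2 \<le> norm y * norm x"
      using quad_ge[of y] norm_cauchy_schwarz[of y x] by (simp add: Ky)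
    have ny: "d * norm y \<le> norm x"
    proof (cases "y = 0")
      case False
      have "norm y * (d * norm y) \<le> norm y * norm x"
        using le e by (smt (verit) mult_nonneg_nonneg zero_le_power2 power2_eq_square mult.commute mult.left_commute)
      then show ?thesis using False by simp
    qed simp
    have "d * (\<epsilon> * (norm (Q *v y))\<^sup>2) \<le> d * (norm y * norm x)"
      using le d by (intro mult_left_mono) (smt (verit) mult_nonneg_nonneg zero_le_power2)+
    also have "\<dots> \<le> norm x * norm x"
      using mult_right_mono[OF ny norm_ge_zero[of x]] by (simp add: mult.assoc)
    finally have "\<epsilon>\<^sup>2 * (d * (\<epsilon> * (norm (Q *v y))\<^sup>2)) \<le> \<epsilon>\<^sup>2 * (norm x * norm x)"
      by (rule mult_left_mono) simp
    then have "(d * norm (Q *v y))\<^sup>2 \<le> (\<epsilon> * norm x)\<^sup>2"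
      by (simp add: d_def power2_eq_square power3_eq_cube algebra_simps)
    then have "d * norm (Q *v y) \<le> \<epsilon> * norm x"
      by (rule power2_le_imp_le) (use e in simp)
    then show ?thesis using d by (simp add: eq)
  qed
  ultimately show ?thesis using that by blast
qed

section \<open>Rank and polynomial families of matrices\<close>

lemma transpose_kernel_trivial_iff_right_invertible:
  fixes A :: "'a::field ^ 'c::finite ^ 'r::finite"
  shows "(\<forall>x. transpose A *v x = 0 \<longrightarrow> x = 0) \<longleftrightarrow> (\<exists>B. A ** B = mat 1)"
  using matrix_left_invertible_ker[of "transpose A"] by (simp add: left_invertible_transpose)

lemma rank_le_card_columns: "rank A \<le> CARD('c)"
  for A :: "'a::field ^ 'c::finite ^ 'r::finite"
  unfolding row_rank_def_gen by (rule dim_subset_UNIV_cart_gen)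

lemma rank_eq_card_columns_iff: "rank A = CARD('c) \<longleftrightarrow> (\<forall>x. A *v x = 0 \<longrightarrow> x = 0)"
  for A :: "'a::field ^ 'c::finite ^ 'r::finite"
proof -
  have "rank A = CARD('c) \<longleftrightarrow> vec.span (rows A) = UNIV"
    unfolding row_rank_def_gen
    using vec.dim_eq_full[of "rows A"] by (simp add: vec.dimension_def card_cart_basis)
  then show ?thesis
    by (simp add: matrix_left_invertible_ker flip: matrix_left_invertible_span_rows_gen)
qed

lemma rank_eq_card_rows:
  fixes A :: "'a::field ^ 'c::finite ^ 'r::finite"
  assumes "\<And>x. transpose A *v x = 0 \<Longrightarrow> x = 0"
  shows "rank A = CARD('r)"
proof -
  have indep: "\<forall>c. (\<Sum>i\<in>UNIV. c i *s row i A) = 0 \<longrightarrow> (\<forall>i. c i = 0)"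
    using assms transpose_kernel_trivial_iff_right_invertible[of A]
      matrix_right_invertible_independent_rows[of A] by blast
  \<comment> \<open>\<open>rows A\<close> is a set, so repeated rows would be counted once; the
    coefficients 1 and -1 exclude them.\<close>
  have inj: "inj (\<lambda>i. row i A)"
  proof (rule injI, rule ccontr)
    fix i j assume "row i A = row j A" "i \<noteq> j"
    then have "(\<Sum>k\<in>UNIV. (if k = i then 1 else if k = j then -1 else 0) *s row k A) = 0"
      by (simp add: if_distrib[of "\<lambda>c. c *s _"] sum.If_cases cong: if_cong)
    then show False using indep[rule_format, of "\<lambda>k. if k = i then 1 else if k = j then -1 else 0" i]
      by simp
  qed
  have rows: "rows A = range (\<lambda>i. row i A)"
    by (auto simp: rows_def)
  have "vec.independent (rows A)"
    unfolding rows
  proof (rule vec.independent_if_scalars_zero)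
    fix f x assume 0: "(\<Sum>x\<in>range (\<lambda>i. row i A). f x *s x) = 0" and "x \<in> range (\<lambda>i. row i A)"
    then obtain i where x: "x = row i A" by blast
    have "(\<Sum>i\<in>UNIV. f (row i A) *s row i A) = 0"
      using 0 by (simp add: sum.reindex[OF inj])
    then show "f x = 0" using indep[rule_format, of "\<lambda>i. f (row i A)" i] x by simp
  qed simp
  then have "vec.dim (rows A) = card (rows A)"
    by (rule vec.dim_eq_card_independent)
  then show ?thesis
    by (simp add: row_rank_def_gen rows card_image[OF inj])
qed

lemma rank_mult_le_left:
  fixes A :: "'a::field ^ 'c::finite ^ 'r::finite"
  shows "rank (A ** B) \<le> rank A"
proof -
  have "row i (A ** B) = transpose B *v row i A" for i
    by (simp add: vec_eq_iff row_def matrix_matrix_mult_def matrix_vector_mult_def transpose_def mult.commute)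
  then have "rows (A ** B) = (*v) (transpose B) ` rows A"
    by (auto simp: rows_def)
  then show ?thesis
    unfolding row_rank_def_gen by (simp only: vec.dim_image_le[OF matrix_vector_mul_linear_gen])
qed

lemma transpose_hcat_mul: "transpose (hcat A B) *v w =
   (\<chi> j. case j of Inl p \<Rightarrow> (transpose A *v w) $ p | Inr q \<Rightarrow> (transpose B *v w) $ q)"
  by (simp add: vec_eq_iff hcat_def transpose_def matrix_vector_mult_def split: sum.split)

lemma transpose_hcat_mul_eq_0_iff:
  "transpose (hcat A B) *v w = 0 \<longleftrightarrow> transpose A *v w = 0 \<and> transpose B *v w = 0"
  by (simp add: transpose_hcat_mul vec_eq_iff split_sum_all)

lemma hcat_mul: "hcat A B *v z = A *v (\<chi> p. z $ Inl p) + B *v (\<chi> q. z $ Inr q)"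
  by (simp add: vec_eq_iff hcat_def matrix_vector_mult_def UNIV_Plus_UNIV[symmetric] sum.Plus
      del: UNIV_Plus_UNIV)

text \<open>Multiplication is real bilinear, so in real coordinates a product is a combination of
  products of real polynomials. This admits complex entries in determinants.\<close>

lemma polynomial_function_mult_K:
  fixes f g :: "'v::real_normed_vector \<Rightarrow> 'k::real_or_complex"
  assumes f: "polynomial_function f" and g: "polynomial_function g"
  shows "polynomial_function (\<lambda>x. f x * g x)"
proof -
  have rp: "real_polynomial_function (\<lambda>x. h x \<bullet> b)" if "polynomial_function h"
    for h :: "'v \<Rightarrow> 'k" and b
    using polynomial_function_inner[OF that, of b] by (simp add: real_polynomial_function_eq)
  have "f x * g x = (\<Sum>b\<in>Basis. \<Sum>c\<in>Basis. ((f x \<bullet> b) * (g x \<bullet> c)) *\<^sub>R (b * c))" for x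
  proof -
    have "f x * g x = (\<Sum>b\<in>Basis. (f x \<bullet> b) *\<^sub>R b) * (\<Sum>c\<in>Basis. (g x \<bullet> c) *\<^sub>R c)"
      by (simp add: euclidean_representation)
    then show ?thesis by (simp add: sum_product mult.commute)
  qed
  moreover have "polynomial_function (\<lambda>x. \<Sum>b\<in>Basis. \<Sum>c\<in>Basis. ((f x \<bullet> b) * (g x \<bullet> c)) *\<^sub>R (b * c))"
    by (intro polynomial_function_sum polynomial_function_mult polynomial_function_const)
       (auto simp flip: real_polynomial_function_eq intro!: rp f g real_polynomial_function.intros(4))
  ultimately show ?thesis by simp
qed

lemma polynomial_function_prod_K:
  fixes f :: "'v::real_normed_vector \<Rightarrow> 'i \<Rightarrow> 'k::real_or_complex"
  assumes "finite I" "\<And>i. i \<in> I \<Longrightarrow> polynomial_function (\<lambda>x. f x i)"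
  shows "polynomial_function (\<lambda>x. prod (f x) I)"
  using assms by (induction I rule: finite_induct) (auto intro: polynomial_function_mult_K)

lemma polynomial_function_det:
  fixes M :: "'v::real_normed_vector \<Rightarrow> 'k::real_or_complex ^ 'n::finite ^ 'n"
  assumes "\<And>i j. polynomial_function (\<lambda>v. M v $ i $ j)"
  shows "polynomial_function (\<lambda>v. det (M v))"
  unfolding det_def
  by (intro polynomial_function_sum polynomial_function_mult_K polynomial_function_prod_K assms
      polynomial_function_const) simp_all

lemma polynomial_function_matrix_mul:
  fixes M :: "'v::real_normed_vector \<Rightarrow> 'k::real_or_complex ^ 'n::finite ^ 'm::finite"
    and N :: "'v \<Rightarrow> 'k ^ 'l::finite ^ 'n"
  assumes "\<And>i j. polynomial_function (\<lambda>v. M v $ i $ j)" "\<And>i j. polynomial_function (\<lambda>v. N v $ i $ j)"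
  shows "polynomial_function (\<lambda>v. (M v ** N v) $ i $ j)"
  unfolding matrix_matrix_mult_def
  by (auto intro!: polynomial_function_sum polynomial_function_mult_K assms)

text \<open>Algebraic sets are cut out by real polynomials; the squared norm turns the nonvanishing
  of a \<open>'k\<close>-valued polynomial into that of a real one.\<close>

lemma polynomial_function_norm_squared:
  fixes f :: "'v::real_normed_vector \<Rightarrow> 'k::euclidean_space"
  assumes "polynomial_function f"
  shows "real_polynomial_function (\<lambda>v. (norm (f v))\<^sup>2)"
proof -
  have "real_polynomial_function (\<lambda>v. (f v \<bullet> b)\<^sup>2)" for b
    using polynomial_function_inner[OF assms, of b]
    by (auto simp flip: real_polynomial_function_eq)
  then have "real_polynomial_function (\<lambda>v. \<Sum>b\<in>Basis. (f v \<bullet> b)\<^sup>2)"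
    by (intro real_polynomial_function_sum) auto
  moreover have "(norm (f v))\<^sup>2 = (\<Sum>b\<in>Basis. (f v \<bullet> b)\<^sup>2)" for v
    by (metis (no_types, lifting) euclidean_inner power2_eq_square power2_norm_eq_inner sum.cong)
  ultimately show ?thesis by simp
qed

text \<open>For a left inverse \<open>G\<close> of \<open>M v0\<close>, the polynomial is \<open>\<bar>det (G ** M v)\<bar>\<^sup>2\<close>.\<close>

lemma injective_matrix_polynomial:
  fixes M :: "'v::real_normed_vector \<Rightarrow> 'k::real_or_complex ^ 'c::finite ^ 'r::finite"
  assumes poly: "\<And>i j. polynomial_function (\<lambda>v. M v $ i $ j)"
    and inj: "\<And>x. M v0 *v x = 0 \<Longrightarrow> x = 0"
  obtains p where "real_polynomial_function p" "p v0 \<noteq> 0"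
    "\<And>v x. p v \<noteq> 0 \<Longrightarrow> map_matrix to_complex (M v) *v x = 0 \<Longrightarrow> x = 0"
proof -
  obtain G where G: "G ** M v0 = mat 1"
    using inj matrix_left_invertible_ker[of "M v0"] by blast
  define p where "p v = (norm (det (G ** M v)))\<^sup>2" for v
  have "real_polynomial_function p"
    unfolding p_def
    by (intro polynomial_function_norm_squared polynomial_function_det polynomial_function_matrix_mul poly)
       simp
  moreover have "p v0 \<noteq> 0"
    by (simp add: p_def G)
  moreover have "x = 0" if "p v \<noteq> 0" and x: "map_matrix to_complex (M v) *v x = 0" for v x
  proof -
    \<comment> \<open>Determinants commute with complexification, so the kernel is trivial over
      complex vectors too; the frequency \<open>z\<close> is complex even when \<open>'k\<close> is
      real.\<close>
    have "det (map_matrix to_complex (G ** M v)) \<noteq> 0"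
      using \<open>p v \<noteq> 0\<close> by (simp add: p_def flip: to_complex_det)
    then have "invertible (map_matrix to_complex (G ** M v))"
      by (simp add: invertible_det_nz)
    moreover have "map_matrix to_complex (G ** M v) =
        map_matrix to_complex G ** map_matrix to_complex (M v)"
      by (simp add: vec_eq_iff matrix_matrix_mult_def to_complex_sum to_complex_mult)
    then have "map_matrix to_complex (G ** M v) *v x = 0"
      by (simp add: x flip: matrix_vector_mul_assoc)
    ultimately show "x = 0"
      by (metis invertible_left_inverse matrix_left_invertible_ker)
  qed
  ultimately show ?thesis using that by blast
qed

section \<open>Relative genericity\<close>

lemma relative_genericI:
  assumes p: "real_polynomial_function p" and dense: "V \<subseteq> closure ({v. p v \<noteq> 0} \<inter> V)"
    and S: "\<And>v. v \<in> V \<Longrightarrow> p v \<noteq> 0 \<Longrightarrow> v \<in> S"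
  shows "relative_generic S V"
  unfolding relative_generic_def
proof (intro exI conjI)
  have "{v. p v = 0} = {v. \<forall>q\<in>{p}. q v = 0}" by simp
  then show "algebraic_set {v. p v = 0}"
    unfolding algebraic_set_def using p by blast
  show "- S \<inter> V \<subseteq> {v. p v = 0} \<inter> V"
    using S by blast
  show "V \<subseteq> closure (- {v. p v = 0} \<inter> V)"
    using dense by (simp add: Collect_neg_eq)
qed

text \<open>A dense subset of \<open>V\<close> meets every nonempty relatively open piece of
  \<open>V\<close>, whatever the algebraic set may be.\<close>

lemma not_relative_genericI:
  assumes U: "open U" "v0 \<in> U" "v0 \<in> V" and S: "U \<inter> V \<inter> S = {}"
  shows "\<not> relative_generic S V"
proof
  assume "relative_generic S V"
  then obtain W where W: "- S \<inter> V \<subseteq> W \<inter> V" "V \<subseteq> closure (- W \<inter> V)"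
    unfolding relative_generic_def by blast
  have "U \<inter> closure (- W \<inter> V) \<noteq> {}"
    using U W by blast
  then have "U \<inter> (- W \<inter> V) \<noteq> {}"
    using open_Int_closure_eq_empty[OF U(1)] by blast
  then show False using W S by blast
qed

text \<open>One nonzero value leaves only finitely many roots, and an interval has infinitely many
  points.\<close>

lemma real_polynomial_function_nonzero_near_0:
  fixes q :: "real \<Rightarrow> real"
  assumes q: "real_polynomial_function q" "q 1 \<noteq> 0" and "0 < \<epsilon>"
  obtains t where "0 < t" "t < \<epsilon>" "t < 1" "q t \<noteq> 0"
proof -
  obtain a n where an: "q = (\<lambda>x. \<Sum>i\<le>n. a i * x ^ i)"
    using real_polynomial_function_imp_sum[OF q(1)] by blast
  have "\<exists>k\<le>n. a k \<noteq> 0"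
    using q(2) by (auto simp: an intro: ccontr)
  then have fin: "finite {x. q x = 0}"
    unfolding an using polyfun_rootbound_finite by blast
  have "infinite {0<..<min \<epsilon> 1}"
    using \<open>0 < \<epsilon>\<close> by (simp add: infinite_Ioo)
  then have "infinite ({0<..<min \<epsilon> 1} - {x. q x = 0})"
    using fin by simp
  then obtain t where "t \<in> {0<..<min \<epsilon> 1} - {x. q x = 0}"
    using infinite_imp_nonempty by blast
  then show ?thesis using that by auto
qed

text \<open>Convexity takes the place of irreducibility: along the segment from any \<open>c\<close>
  to \<open>c0\<close>, the composition of \<open>p\<close> and \<open>\<phi>\<close> is a
  polynomial in one variable that is nonzero at the end \<open>t = 1\<close>, hence at arbitrarily
  small \<open>t > 0\<close>.\<close>

lemma dense_nonzero_parametrized: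
  fixes \<phi> :: "'c::euclidean_space \<Rightarrow> 'v::euclidean_space"
  assumes C: "convex C" "c0 \<in> C" and \<phi>: "polynomial_function \<phi>" "\<phi> ` C \<subseteq> V" "V \<subseteq> closure (\<phi> ` C)"
    and p: "real_polynomial_function p" "p (\<phi> c0) \<noteq> 0"
  shows "V \<subseteq> closure ({v. p v \<noteq> 0} \<inter> V)"
proof -
  have "\<phi> c \<in> closure ({v. p v \<noteq> 0} \<inter> V)" if c: "c \<in> C" for c
    unfolding closure_approachable
  proof (intro allI impI)
    fix e :: real assume "0 < e"
    define \<gamma> where "\<gamma> t = \<phi> ((1 - t) *\<^sub>R c + t *\<^sub>R c0)" for t :: real
    have lin: "polynomial_function (\<lambda>t::real. (1 - t) *\<^sub>R c + t *\<^sub>R c0)"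
      by (intro polynomial_function_add polynomial_function_mult polynomial_function_diff) auto
    have \<gamma>: "polynomial_function \<gamma>"
      using polynomial_function_compose[OF lin \<phi>(1)] by (simp add: \<gamma>_def[abs_def] o_def)
    have "isCont \<gamma> 0"
      using continuous_polymonial_function[OF \<gamma>] .
    then have "\<exists>d>0. \<forall>t. dist t 0 < d \<longrightarrow> dist (\<gamma> t) (\<gamma> 0) < e"
      using \<open>0 < e\<close> unfolding continuous_at_eps_delta[of 0 \<gamma>] by blast
    then obtain d where d: "0 < d" "\<And>t. dist t 0 < d \<Longrightarrow> dist (\<gamma> t) (\<gamma> 0) < e" by blast
    have "real_polynomial_function (p \<circ> \<gamma>)" "(p \<circ> \<gamma>) 1 \<noteq> 0"
      using real_polynomial_function_compose[OF \<gamma> p(1)] p(2) by (auto simp: \<gamma>_def)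
    then obtain t where t: "0 < t" "t < d" "t < 1" "(p \<circ> \<gamma>) t \<noteq> 0"
      using real_polynomial_function_nonzero_near_0[of "p \<circ> \<gamma>" d] d(1) by blast
    have "(1 - t) *\<^sub>R c + t *\<^sub>R c0 \<in> C"
      using t C c by (intro convexD) auto
    then have "\<gamma> t \<in> V" using \<phi>(2) by (auto simp: \<gamma>_def)
    moreover have "dist (\<gamma> t) (\<phi> c) < e"
      using d(2)[of t] t by (simp add: \<gamma>_def)
    ultimately show "\<exists>y\<in>{v. p v \<noteq> 0} \<inter> V. dist y (\<phi> c) < e"
      using t by auto
  qed
  then have "closure (\<phi> ` C) \<subseteq> closure ({v. p v \<noteq> 0} \<inter> V)"
    by (intro closure_minimal) auto
  then show ?thesis using \<phi>(3) by blast
qed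

section \<open>Dense parametrization of the reference sets\<close>

lemma polynomial_function_bounded_linear_compose:
  "bounded_linear L \<Longrightarrow> polynomial_function f \<Longrightarrow> polynomial_function (\<lambda>v. L (f v))"
  using polynomial_function_compose[of f L] polynomial_function_bounded_linear[of L]
  by (simp add: o_def)

lemma polynomial_function_vec_nth: "polynomial_function f \<Longrightarrow> polynomial_function (\<lambda>v. f v $ i)"
  by (rule polynomial_function_bounded_linear_compose[OF bounded_linear_vec_nth])

lemma polynomial_function_fst: "polynomial_function f \<Longrightarrow> polynomial_function (\<lambda>v. fst (f v))"
  by (rule polynomial_function_bounded_linear_compose[OF bounded_linear_fst])

lemma polynomial_function_snd: "polynomial_function f \<Longrightarrow> polynomial_function (\<lambda>v. snd (f v))"
  by (rule polynomial_function_bounded_linear_compose[OF bounded_linear_snd])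

lemma polynomial_function_Pair:
  fixes f :: "'v::real_normed_vector \<Rightarrow> 'a::euclidean_space" and g :: "'v \<Rightarrow> 'b::euclidean_space"
  assumes "polynomial_function f" "polynomial_function g"
  shows "polynomial_function (\<lambda>v. (f v, g v))"
  using assms unfolding polynomial_function_iff_Basis_inner Basis_prod_def by auto

lemma polynomial_function_vecI:
  fixes f :: "'v::real_normed_vector \<Rightarrow> 'a::euclidean_space ^ 'n::finite"
  assumes "\<And>i. polynomial_function (\<lambda>v. f v $ i)"
  shows "polynomial_function f"
  using assms unfolding polynomial_function_iff_Basis_inner Basis_vec_def
  by (auto simp: inner_axis)

lemmas polynomial_function_projections =
  polynomial_function_vec_nth polynomial_function_fst polynomial_function_snd polynomial_function_id

lemma polynomial_function_matrix_mult:
  fixes M :: "'v::real_normed_vector \<Rightarrow> 'k::real_or_complex ^ 'n::finite ^ 'm::finite"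
  assumes "polynomial_function M" "polynomial_function N"
  shows "polynomial_function (\<lambda>v. M v ** N v)"
  by (intro polynomial_function_vecI, rule polynomial_function_matrix_mul)
     (intro polynomial_function_vec_nth assms)+

lemma matrix_vector_mult_axis: "(M *v axis j 1) $ i = M $ i $ j"
  for M :: "'a::semiring_1 ^ 'n::finite ^ 'm::finite"
  by (simp add: matrix_vector_mult_def axis_def if_distrib cong: if_cong)

lemma psd_factor_sequence:
  fixes E Q :: "('k::real_or_complex, 'l::finite, 'n::finite) matrix"
  assumes "adj E ** Q = adj Q ** E" "psd (adj E ** Q)"
  obtains X S where "\<And>k::nat. psd (S k)" "X \<longlonglongrightarrow> E" "(\<lambda>k. S k ** X k) \<longlonglongrightarrow> Q"
proof -
  define \<epsilon> where "\<epsilon> k = inverse (real (Suc k))" for k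
  have \<epsilon>: "\<epsilon> \<longlonglongrightarrow> 0" "\<epsilon> k > 0" for k
    unfolding \<epsilon>_def using LIMSEQ_inverse_real_of_nat by auto
  define X where "X k = E + \<epsilon> k *\<^sub>R Q" for k
  have "\<exists>S. psd S \<and> (\<forall>x. norm ((Q - S ** X k) *v x) \<le> \<epsilon> k * norm x)" for k
    unfolding X_def using psd_factor_approx[OF assms \<epsilon>(2), of k] by blast
  then obtain S where S: "\<And>k. psd (S k)" "\<And>k x. norm ((Q - S k ** X k) *v x) \<le> \<epsilon> k * norm x"
    by metis
  have "(\<lambda>k. E + \<epsilon> k *\<^sub>R Q) \<longlonglongrightarrow> E + 0 *\<^sub>R Q"
    by (intro tendsto_intros \<epsilon>)
  then have "X \<longlonglongrightarrow> E" by (simp add: X_def[abs_def])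
  moreover have "(\<lambda>k. Q - S k ** X k) \<longlonglongrightarrow> 0"
  proof (intro vec_tendstoI)
    fix i j
    have "norm ((Q - S k ** X k) $ i $ j) \<le> \<epsilon> k" for k
    proof -
      \<comment> \<open>An entry is a coordinate of the image of a unit vector, to which the bound
        in \<open>S\<close> applies.\<close>
      have "(Q - S k ** X k) $ i $ j = ((Q - S k ** X k) *v axis j 1) $ i"
        by (simp only: matrix_vector_mult_axis)
      also have "norm \<dots> \<le> norm ((Q - S k ** X k) *v axis j 1)"
        by (rule Finite_Cartesian_Product.norm_nth_le)
      also have "\<dots> \<le> \<epsilon> k * norm (axis j (1::'k))" by (rule S)
      also have "norm (axis j (1::'k)) = 1"
        by (simp add: norm_eq_1 inner_axis_axis power2_norm_eq_inner[of "1::'k", symmetric])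
      finally show ?thesis by simp
    qed
    then have "(\<lambda>k. (Q - S k ** X k) $ i $ j) \<longlonglongrightarrow> 0"
      by (intro Lim_null_comparison[OF _ \<epsilon>(1)] always_eventually) blast
    then show "(\<lambda>k. (Q - S k ** X k) $ i $ j) \<longlonglongrightarrow> (0 :: 'k ^ 'n ^ 'l) $ i $ j" by simp
  qed
  then have "(\<lambda>k. Q - (Q - S k ** X k)) \<longlonglongrightarrow> Q - 0"
    by (intro tendsto_intros)
  then have "(\<lambda>k. S k ** X k) \<longlonglongrightarrow> Q" by simp
  ultimately show ?thesis using S(1) that by blast
qed

lemma adj_congruence_Hermitian:
  assumes "psd S" shows "adj E ** (S ** E) = adj (S ** E) ** E" "psd (adj E ** (S ** E))"
  using psd_congruence[OF assms, of E] by (simp_all add: psd_adj[OF assms] matrix_mul_assoc)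

text \<open>\<open>E0\<close> fills the places of both \<open>E\<close> and \<open>Q\<close> because
  the base point is the image of the parameter \<open>S = mat 1\<close>.\<close>

lemma dense_nonzero_Sigma_H:
  fixes p :: "('k::real_or_complex, 'l::finite, 'n::finite, 'm::finite) ham \<Rightarrow> real"
  assumes p: "real_polynomial_function p" "p (E0, J0, E0, B0) \<noteq> 0" and J0: "J0 = - adj J0"
  shows "Sigma_H \<subseteq> closure ({v. p v \<noteq> 0} \<inter> Sigma_H)"
proof (rule dense_nonzero_parametrized)
  let ?C = "UNIV \<times> {J. J = - adj J} \<times> {S. psd S} \<times> UNIV ::
    (('k, 'l, 'n) matrix \<times> ('k, 'l, 'l) matrix \<times> ('k, 'l, 'l) matrix \<times> ('k, 'l, 'm) matrix) set"
  let ?\<phi> = "\<lambda>c :: ('k, 'l, 'n) matrix \<times> ('k, 'l, 'l) matrix \<times> ('k, 'l, 'l) matrix \<times> ('k, 'l, 'm) matrix.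
    (fst c, fst (snd c), fst (snd (snd c)) ** fst c, snd (snd (snd c)))"
  show "convex ?C"
    by (intro convex_Times convex_UNIV convex_skew convex_psd)
  show "(E0, J0, mat 1, B0) \<in> ?C"
    by (intro SigmaI UNIV_I CollectI J0 pd_imp_psd[OF pd_mat_1])
  show "p (?\<phi> (E0, J0, mat 1, B0)) \<noteq> 0"
    using p(2) by simp
  show "polynomial_function ?\<phi>"
    by (intro polynomial_function_Pair polynomial_function_matrix_mult polynomial_function_projections)
  show "?\<phi> ` ?C \<subseteq> Sigma_H"
  proof (rule image_subsetI)
    fix c assume "c \<in> ?C"
    then obtain E J S B where c: "c = (E, J, S, B)" and *: "J = - adj J" "psd S"
      by blast
    show "?\<phi> c \<in> Sigma_H"
      unfolding c Sigma_H_def mem_Collect_eq prod.case fst_conv snd_conv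
      by (intro conjI * adj_congruence_Hermitian)
  qed
  show "Sigma_H \<subseteq> closure (?\<phi> ` ?C)"
  proof
    fix v :: "('k, 'l, 'n, 'm) ham" assume "v \<in> Sigma_H"
    then obtain E J Q B where v: "v = (E, J, Q, B)" "J = - adj J" "adj E ** Q = adj Q ** E"
      "psd (adj E ** Q)"
      unfolding Sigma_H_def by blast
    obtain X S where S: "\<And>k::nat. psd (S k)" and lim: "X \<longlonglongrightarrow> E" "(\<lambda>k. S k ** X k) \<longlonglongrightarrow> Q"
      using psd_factor_sequence[OF v(3,4)] by blast
    have "?\<phi> (X k, J, S k, B) \<in> ?\<phi> ` ?C" for k
      by (intro imageI SigmaI UNIV_I CollectI v(2) S)
    moreover have "(\<lambda>k. ?\<phi> (X k, J, S k, B)) \<longlonglongrightarrow> v"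
      unfolding v(1) by (simp, intro tendsto_intros lim)
    ultimately show "v \<in> closure (?\<phi> ` ?C)"
      unfolding closure_sequential by (intro exI conjI allI)
  qed
qed (rule p(1))

text \<open>\<open>D\<close> stands for the semidefinite or the definite cone. The approximating
  sequence keeps \<open>R\<close> fixed, so \<open>D\<close> may fail to be closed, as the definite
  cone does.\<close>

lemma dense_nonzero_dissipative:
  fixes p :: "('k::real_or_complex, 'l::finite, 'n::finite, 'm::finite) diss_ham \<Rightarrow> real"
  assumes p: "real_polynomial_function p" "p (E0, J0, R0, E0, B0) \<noteq> 0" and J0: "J0 = - adj J0"
    and D: "convex D" "R0 \<in> D"
    and V: "V = {(E, J, R, Q, B). J = - adj J \<and> R \<in> D \<and> adj E ** Q = adj Q ** E \<and> psd (adj E ** Q)}"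
  shows "V \<subseteq> closure ({v. p v \<noteq> 0} \<inter> V)"
proof (rule dense_nonzero_parametrized)
  let ?C = "UNIV \<times> {J. J = - adj J} \<times> D \<times> {S. psd S} \<times> UNIV ::
    (('k, 'l, 'n) matrix \<times> ('k, 'l, 'l) matrix \<times> ('k, 'l, 'l) matrix \<times> ('k, 'l, 'l) matrix \<times>
     ('k, 'l, 'm) matrix) set"
  let ?\<phi> = "\<lambda>c :: ('k, 'l, 'n) matrix \<times> ('k, 'l, 'l) matrix \<times> ('k, 'l, 'l) matrix \<times>
      ('k, 'l, 'l) matrix \<times> ('k, 'l, 'm) matrix.
    (fst c, fst (snd c), fst (snd (snd c)), fst (snd (snd (snd c))) ** fst c, snd (snd (snd (snd c))))"
  show "convex ?C"
    by (intro convex_Times convex_UNIV convex_skew convex_psd D)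
  show "(E0, J0, R0, mat 1, B0) \<in> ?C"
    by (intro SigmaI UNIV_I CollectI J0 D pd_imp_psd[OF pd_mat_1])
  show "p (?\<phi> (E0, J0, R0, mat 1, B0)) \<noteq> 0"
    using p(2) by simp
  show "polynomial_function ?\<phi>"
    by (intro polynomial_function_Pair polynomial_function_matrix_mult polynomial_function_projections)
  show "?\<phi> ` ?C \<subseteq> V"
  proof (rule image_subsetI)
    fix c assume "c \<in> ?C"
    then obtain E J R S B where c: "c = (E, J, R, S, B)" and *: "J = - adj J" "R \<in> D" "psd S"
      by blast
    show "?\<phi> c \<in> V"
      unfolding c V mem_Collect_eq prod.case fst_conv snd_conv
      by (intro conjI * adj_congruence_Hermitian)
  qed
  show "V \<subseteq> closure (?\<phi> ` ?C)"
  proof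
    fix v :: "('k, 'l, 'n, 'm) diss_ham" assume "v \<in> V"
    then obtain E J R Q B where v: "v = (E, J, R, Q, B)" "J = - adj J" "R \<in> D"
      "adj E ** Q = adj Q ** E" "psd (adj E ** Q)"
      unfolding V by blast
    obtain X S where S: "\<And>k::nat. psd (S k)" and lim: "X \<longlonglongrightarrow> E" "(\<lambda>k. S k ** X k) \<longlonglongrightarrow> Q"
      using psd_factor_sequence[OF v(4,5)] by blast
    have "?\<phi> (X k, J, R, S k, B) \<in> ?\<phi> ` ?C" for k
      by (intro imageI SigmaI UNIV_I CollectI v(2,3) S)
    moreover have "(\<lambda>k. ?\<phi> (X k, J, R, S k, B)) \<longlonglongrightarrow> v"
      unfolding v(1) by (simp, intro tendsto_intros lim)
    ultimately show "v \<in> closure (?\<phi> ` ?C)"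
      unfolding closure_sequential by (intro exI conjI allI)
  qed
qed (rule p(1))

lemma dense_nonzero_Sigma_sdH:
  fixes p :: "('k::real_or_complex, 'l::finite, 'n::finite, 'm::finite) diss_ham \<Rightarrow> real"
  assumes "real_polynomial_function p" "p (E0, J0, R0, E0, B0) \<noteq> 0" "J0 = - adj J0" "psd R0"
  shows "Sigma_sdH \<subseteq> closure ({v. p v \<noteq> 0} \<inter> Sigma_sdH)"
proof (rule dense_nonzero_dissipative[OF assms(1-3) convex_psd])
  have "R = adj R \<and> psd R \<longleftrightarrow> psd R" for R :: "('k, 'l, 'l) matrix"
    using sym[OF psd_adj, of R] by blast
  then show "(Sigma_sdH :: ('k, 'l, 'n, 'm) diss_ham set) = {(E, J, R, Q, B). J = - adj J \<and>
      R \<in> {R. psd R} \<and> adj E ** Q = adj Q ** E \<and> psd (adj E ** Q)}"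
    unfolding Sigma_sdH_def mem_Collect_eq by blast
qed (simp add: assms(4))

lemma dense_nonzero_Sigma_dH:
  fixes p :: "('k::real_or_complex, 'l::finite, 'n::finite, 'm::finite) diss_ham \<Rightarrow> real"
  assumes "real_polynomial_function p" "p (E0, J0, R0, E0, B0) \<noteq> 0" "J0 = - adj J0" "pd R0"
  shows "Sigma_dH \<subseteq> closure ({v. p v \<noteq> 0} \<inter> Sigma_dH)"
proof (rule dense_nonzero_dissipative[OF assms(1-3) convex_pd])
  have "R = adj R \<and> pd R \<longleftrightarrow> pd R" for R :: "('k, 'l, 'l) matrix"
    using sym[OF pd_adj, of R] by blast
  then show "(Sigma_dH :: ('k, 'l, 'n, 'm) diss_ham set) = {(E, J, R, Q, B). J = - adj J \<and>
      R \<in> {R. pd R} \<and> adj E ** Q = adj Q ** E \<and> psd (adj E ** Q)}"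
    unfolding Sigma_dH_def mem_Collect_eq by blast
qed (simp add: assms(4))

section \<open>Kernels of the pencil and stabilizability\<close>

definition complex_pencil :: "complex \<Rightarrow> ('k::real_or_complex, 'l::finite, 'n::finite) matrix
    \<Rightarrow> ('k, 'l, 'n) matrix \<Rightarrow> ('k, 'l, 'm::finite) matrix \<Rightarrow> (complex, 'l, 'n + 'm) matrix" where
  "complex_pencil z E A B =
    hcat (pencil z (map_matrix to_complex E) (map_matrix to_complex A)) (map_matrix to_complex B)"

lemma rank_pencil_at_eq: "rank_pencil_at z E A B = rank (complex_pencil z E A B)"
  by (simp add: rank_pencil_at_def complex_pencil_def)

lemma pencil_mul: "pencil z E A *v x = z *s (E *v x) - A *v x"
  by (simp add: vec_eq_iff pencil_def matrix_vector_mult_def sum_distrib_left sum_subtractf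
      left_diff_distrib mult.assoc)

lemma transpose_pencil: "transpose (pencil z E A) = pencil z (transpose E) (transpose A)"
  by (simp add: vec_eq_iff pencil_def transpose_def)

lemma map_matrix_pencil: "map_matrix to_complex (hcat (pencil a E A) B) = complex_pencil (to_complex a) E A B"
  by (simp add: complex_pencil_def vec_eq_iff hcat_def pencil_def to_complex_mult split: sum.split)

lemma map_matrix_transpose: "map_matrix f (transpose M) = transpose (map_matrix f M)"
  by (simp add: vec_eq_iff transpose_def)

lemma map_matrix_to_complex_mul:
  "map_matrix to_complex M *v (\<chi> i. to_complex (x $ i)) = (\<chi> i. to_complex ((M *v x) $ i))"
  by (simp add: vec_eq_iff matrix_vector_mult_def to_complex_sum to_complex_mult)

lemma kernel_of_complexification:
  assumes "\<And>x. map_matrix to_complex M *v x = 0 \<Longrightarrow> x = 0" and "M *v x = 0"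
  shows "x = 0"
proof -
  have "(\<chi> i. to_complex (x $ i)) = 0"
    by (rule assms(1)) (simp add: map_matrix_to_complex_mul assms(2) vec_eq_iff)
  then show ?thesis by (simp add: vec_eq_iff)
qed

section \<open>Ranks over the rational functions\<close>

lemma fract_common_denominator:
  fixes y :: "'a::idom fract ^ 'c::finite"
  obtains q u where "q \<noteq> 0" "\<And>j. to_fract q * y $ j = to_fract (u j)"
proof -
  have "\<exists>a b. b \<noteq> 0 \<and> to_fract b * y $ j = to_fract a" for j
  proof (cases "y $ j" rule: Fract_cases)
    case (Fract a b)
    then have "to_fract b * y $ j = to_fract a"
      by (simp add: Fract_conv_to_fract)
    with Fract show ?thesis by blast
  qed
  then obtain a b where ab: "\<And>j. b j \<noteq> 0" "\<And>j. to_fract (b j) * y $ j = to_fract (a j)"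
    by metis
  define q where "q = (\<Prod>j\<in>UNIV. b j)"
  have "to_fract q * y $ j = to_fract (a j * (\<Prod>i\<in>UNIV - {j}. b i))" for j
  proof -
    have "q = b j * (\<Prod>i\<in>UNIV - {j}. b i)"
      unfolding q_def by (rule prod.remove) auto
    then show ?thesis using ab(2)[of j] by (simp add: algebra_simps)
  qed
  moreover have "q \<noteq> 0" using ab(1) by (simp add: q_def)
  ultimately show ?thesis by (intro that)
qed

text \<open>A kernel vector over the rational functions, cleared of denominators, is a polynomial vector;
  evaluate it where it does not vanish.\<close>

lemma kernel_over_fract:
  fixes M :: "'a::field_char_0 poly ^ 'c::finite ^ 'r::finite"
  assumes inj: "\<And>a x. map_matrix (\<lambda>p. poly p a) M *v x = 0 \<Longrightarrow> x = 0"
    and y: "map_matrix to_fract M *v y = 0"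
  shows "y = 0"
proof (rule ccontr)
  assume "y \<noteq> 0"
  then obtain j0 where j0: "y $ j0 \<noteq> 0" by (auto simp: vec_eq_iff)
  obtain q u where q: "q \<noteq> 0" "\<And>j. to_fract q * y $ j = to_fract (u j)"
    using fract_common_denominator[of y] by blast
  have "u j0 \<noteq> 0"
    using q j0 by (metis mult_eq_0_iff to_fract_eq_0_iff)
  \<comment> \<open>In characteristic 0 the field is infinite, so a nonzero polynomial has a nonzero
    value.\<close>
  then obtain a where a: "poly (u j0) a \<noteq> 0"
    using poly_all_0_iff_0 by blast
  have "(\<Sum>j\<in>UNIV. M $ i $ j * u j) = 0" for i
  proof -
    have "to_fract (\<Sum>j\<in>UNIV. M $ i $ j * u j) = (\<Sum>j\<in>UNIV. to_fract (M $ i $ j) * (to_fract q * y $ j))"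
      by (simp add: q(2))
    also have "\<dots> = to_fract q * (\<Sum>j\<in>UNIV. to_fract (M $ i $ j) * y $ j)"
      by (simp add: sum_distrib_left mult.left_commute)
    also have "\<dots> = 0"
      using y by (simp add: vec_eq_iff matrix_vector_mult_def)
    finally show ?thesis by (simp only: to_fract_eq_0_iff)
  qed
  then have "poly (\<Sum>j\<in>UNIV. M $ i $ j * u j) a = 0" for i by simp
  then have "map_matrix (\<lambda>p. poly p a) M *v (\<chi> j. poly (u j) a) = 0"
    by (simp add: vec_eq_iff matrix_vector_mult_def poly_sum)
  then have "(\<chi> j. poly (u j) a) = 0" by (rule inj)
  then show False using a by (simp add: vec_eq_iff)
qed

text \<open>The common source of two matrices: \<open>to_fract\<close> takes it to the pencil over
  the rational functions, evaluation at a scalar to a constant pencil.\<close>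

definition poly_pencil :: "('k::field, 'l::finite, 'n::finite) matrix \<Rightarrow> ('k, 'l, 'n) matrix
    \<Rightarrow> ('k, 'l, 'm::finite) matrix \<Rightarrow> ('k poly, 'l, 'n + 'm) matrix" where
  "poly_pencil E A B =
    (\<chi> i j. case j of Inl p \<Rightarrow> [: - A $ i $ p, E $ i $ p :] | Inr q \<Rightarrow> [: B $ i $ q :])"

lemma rank_pencil_fract_eq: "rank_pencil_fract E A B = rank (map_matrix to_fract (poly_pencil E A B))"
proof -
  have "to_fract [: - a, e :] = to_fract [:0, 1:] * to_fract [:e:] - to_fract [:a:]" for a e :: 'a
  proof -
    have "[: - a, e :] = [:0, 1:] * [:e:] - [:a:]" by simp
    then show ?thesis by (simp only: to_fract_mult to_fract_diff)
  qed
  then have "map_matrix to_fract (poly_pencil E A B) =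
      hcat (pencil (to_fract [:0, 1:]) (map_matrix (\<lambda>a. to_fract [:a:]) E)
        (map_matrix (\<lambda>a. to_fract [:a:]) A)) (map_matrix (\<lambda>a. to_fract [:a:]) B)"
    by (simp add: vec_eq_iff poly_pencil_def hcat_def pencil_def split: sum.split)
  then show ?thesis
    by (simp add: rank_pencil_fract_def Let_def)
qed

lemma poly_poly_pencil: "map_matrix (\<lambda>p. poly p a) (poly_pencil E A B) = hcat (pencil a E A) B"
  by (simp add: vec_eq_iff poly_pencil_def hcat_def pencil_def split: sum.split)

text \<open>Trivial kernels at all scalars force a trivial kernel over the rational functions
  (\<open>kernel_over_fract\<close>), so both ranks equal the number of columns.\<close>

lemma behavioural_stabilizable_tall:
  fixes E A :: "('k::real_or_complex, 'l::finite, 'n::finite) matrix" and B :: "('k, 'l, 'm::finite) matrix"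
  assumes "\<And>z x. complex_pencil z E A B *v x = 0 \<Longrightarrow> x = 0"
  shows "(E, A, B) \<in> behavioural_stabilizable"
proof -
  have "x = 0" if "map_matrix (\<lambda>p. poly p a) (poly_pencil E A B) *v x = 0" for a x
    using kernel_of_complexification[of "hcat (pencil a E A) B" x] assms that
    by (simp add: map_matrix_pencil poly_poly_pencil)
  then have "rank_pencil_fract E A B = CARD('n + 'm)"
    unfolding rank_pencil_fract_eq rank_eq_card_columns_iff using kernel_over_fract by blast
  moreover have "rank_pencil_at z E A B = CARD('n + 'm)" for z
    unfolding rank_pencil_at_eq rank_eq_card_columns_iff using assms by blast
  ultimately show ?thesis by (simp add: behavioural_stabilizable_def)
qed

text \<open>The number of rows bounds every rank in the three definitions, and the two hypotheses
  make each of them attain this bound.\<close>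

lemma stabilizable_wide:
  fixes E A :: "('k::real_or_complex, 'l::finite, 'n::finite) matrix" and B :: "('k, 'l, 'm::finite) matrix"
  assumes pencil: "\<And>z w. transpose (complex_pencil z E A B) *v w = 0 \<Longrightarrow> w = 0"
    and EB: "\<And>w. transpose (hcat E B) *v w = 0 \<Longrightarrow> w = 0"
  shows "(E, A, B) \<in> behavioural_stabilizable \<inter> completely_stabilizable \<inter> strongly_stabilizable"
proof -
  have at: "rank_pencil_at z E A B = CARD('l)" for z
    unfolding rank_pencil_at_eq using pencil by (rule rank_eq_card_rows)
  have "w = 0" if "map_matrix (\<lambda>p. poly p a) (transpose (poly_pencil E A B)) *v w = 0" for a w
    using kernel_of_complexification[of "transpose (hcat (pencil a E A) B)" w] pencil that
    by (simp add: map_matrix_transpose map_matrix_pencil poly_poly_pencil)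
  then have "y = 0" if "transpose (map_matrix to_fract (poly_pencil E A B)) *v y = 0" for y
    using kernel_over_fract[of "transpose (poly_pencil E A B)" y] that
    by (simp add: map_matrix_transpose)
  then have "rank_pencil_fract E A B = CARD('l)"
    unfolding rank_pencil_fract_eq by (rule rank_eq_card_rows)
  then have "(E, A, B) \<in> behavioural_stabilizable"
    by (simp add: behavioural_stabilizable_def at)
  moreover have rEB: "rank (hcat E B) = CARD('l)"
    using EB by (rule rank_eq_card_rows)
  moreover have rEAB: "rank (hcat E (hcat A B)) = CARD('l)"
    by (rule rank_eq_card_rows) (use EB in \<open>simp only: transpose_hcat_mul_eq_0_iff\<close>)
  \<comment> \<open>The columns of \<open>E\<close> and \<open>B\<close> already span the whole
    space, so one value covers every choice of \<open>Z\<close>.\<close>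
  moreover have dim: "vec.dim (columns E \<union> T \<union> columns B) = CARD('l)" for T
  proof -
    have "columns (hcat E B) \<subseteq> columns E \<union> columns B"
    proof
      fix c assume "c \<in> columns (hcat E B)"
      then obtain j where c: "c = column j (hcat E B)" by (auto simp: columns_def)
      show "c \<in> columns E \<union> columns B"
        by (cases j) (auto simp: c columns_def column_def hcat_def)
    qed
    moreover have "vec.span (columns (hcat E B)) = UNIV"
      using EB transpose_kernel_trivial_iff_right_invertible[of "hcat E B"]
        matrix_right_invertible_span_columns[of "hcat E B"] by blast
    ultimately have "vec.span (columns E \<union> T \<union> columns B) = UNIV"
      using vec.span_mono[of "columns (hcat E B)" "columns E \<union> T \<union> columns B"] by blast
    then show ?thesis
      using vec.dim_eq_full[of "columns E \<union> T \<union> columns B"] by (simp add: vec.dimension_def card_cart_basis)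
  qed
  ultimately show ?thesis
    unfolding Int_iff completely_stabilizable_def strongly_stabilizable_def mem_Collect_eq prod.case
    by (intro conjI ballI allI impI) (simp_all only: at rEB rEAB dim)
qed

text \<open>When \<open>E\<close> is injective, the empty list is an admissible \<open>Z\<close> in strong stabilizability.\<close>

lemma strongly_stabilizable_rank:
  fixes E A :: "('k::real_or_complex, 'l::finite, 'n::finite) matrix" and B :: "('k, 'l, 'm::finite) matrix"
  assumes "(E, A, B) \<in> strongly_stabilizable" "\<And>x. E *v x = 0 \<Longrightarrow> x = 0" "z \<in> closed_rhp"
  shows "rank (hcat E (hcat A B)) = rank_pencil_at z E A B"
proof -
  have "rank E = CARD('n)"
    using assms(2) rank_eq_card_columns_iff[of E] by blast
  moreover have "{v. E *v v = 0} = {0}"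
    using assms(2) by auto
  ultimately have "length ([] :: ('k ^ 'n) list) = CARD('n) - rank E \<and>
      vec.span (set ([] :: ('k ^ 'n) list)) = {v. E *v v = 0}"
    by simp
  with assms(1,3) show ?thesis
    unfolding strongly_stabilizable_def mem_Collect_eq prod.case by metis
qed

text \<open>Each property equates the rank at \<open>z\<close> with a number that does not mention
  \<open>z\<close>; in the strong case injectivity of \<open>E\<close> supplies the admissible
  \<open>Z\<close> for this.\<close>

lemma stabilizable_rank_constant:
  fixes E A :: "('k::real_or_complex, 'l::finite, 'n::finite) matrix" and B :: "('k, 'l, 'm::finite) matrix"
  assumes "(E, A, B) \<in> behavioural_stabilizable \<union> completely_stabilizable \<union> strongly_stabilizable"
    and "\<And>x. E *v x = 0 \<Longrightarrow> x = 0" and "z \<in> closed_rhp" "z' \<in> closed_rhp"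
  shows "rank_pencil_at z E A B = rank_pencil_at z' E A B"
proof -
  consider "(E, A, B) \<in> behavioural_stabilizable" | "(E, A, B) \<in> completely_stabilizable"
    | "(E, A, B) \<in> strongly_stabilizable"
    using assms(1) by blast
  then show ?thesis
  proof cases
    case 3
    then show ?thesis using strongly_stabilizable_rank assms(2-) by metis
  next
    case 1
    then show ?thesis
      using assms(3,4) unfolding behavioural_stabilizable_def mem_Collect_eq prod.case by metis
  next
    case 2
    then show ?thesis
      using assms(3,4) unfolding completely_stabilizable_def mem_Collect_eq prod.case by metis
  qed
qed

section \<open>Elimination of the frequency variable\<close>

text \<open>Time steps and path positions need a successor, which a finite index type lacks;
  \<open>e\<close> and \<open>d\<close> translate between the type and an initial segment of the
  naturals.\<close>

lemma ex_enumeration: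
  obtains e :: "'a::finite \<Rightarrow> nat" and d
  where "\<And>t. e t < CARD('a)" "\<And>k. k < CARD('a) \<Longrightarrow> e (d k) = k"
    "\<And>t. d (e t) = t"
proof -
  obtain e :: "'a \<Rightarrow> nat" where e: "bij_betw e UNIV {..<CARD('a)}"
    using ex_bij_betw_finite_nat[of "UNIV :: 'a set"] by (auto simp: lessThan_atLeast0)
  define d where "d = inv_into UNIV e"
  have "e (d k) = k" if "k < CARD('a)" for k
    using e that unfolding d_def by (simp add: bij_betw_inv_into_right)
  moreover have "d (e t) = t" for t
    using e unfolding d_def by (simp add: bij_betw_inv_into_left)
  moreover have "e t < CARD('a)" for t
    using e by (auto simp: bij_betw_def)
  ultimately show ?thesis using that by blast
qed

lemma sum_pair: "(\<Sum>x\<in>UNIV. f x) = (\<Sum>i\<in>UNIV. \<Sum>s\<in>UNIV. f (i, s))"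
  for f :: "'a::finite \<times> 'b::finite \<Rightarrow> 'c::comm_monoid_add"
  by (simp add: sum.cartesian_product)

lemma sum_Plus: "(\<Sum>x\<in>UNIV. f x) = (\<Sum>i\<in>UNIV. f (Inl i)) + (\<Sum>s\<in>UNIV. f (Inr s))"
  for f :: "'a::finite + 'b::finite \<Rightarrow> 'c::comm_monoid_add"
  by (simp add: UNIV_Plus_UNIV[symmetric] sum.Plus del: UNIV_Plus_UNIV)

text \<open>
  A vector \<open>w\<close> in the left kernel of \<open>[zE - A, B]\<close> makes \<open>w, z w, z\<^sup>2 w, \<dots>\<close> a solution of the
  linear recurrence \<open>E\<^sup>T w\<^sub>t\<^sub>+\<^sub>1 = A\<^sup>T w\<^sub>t\<close>, \<open>B\<^sup>T w\<^sub>t = 0\<close>, from which \<open>z\<close> has disappeared.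
\<close>

definition wide_recurrence :: "('l::finite \<Rightarrow> nat) \<Rightarrow> (nat \<Rightarrow> 'l)
    \<Rightarrow> ('k::field, 'l, 'n::finite) matrix \<Rightarrow> ('k, 'l, 'n) matrix \<Rightarrow> ('k, 'l, 'm::finite) matrix
    \<Rightarrow> 'k ^ ('l \<times> 'l) ^ (('n + 'm) \<times> 'l)" where
  "wide_recurrence e d E A B = (\<chi> r c. case r of
     (Inl p, t) \<Rightarrow> if Suc (e t) < CARD('l)
        then (if snd c = d (Suc (e t)) then E $ fst c $ p else 0) - (if snd c = t then A $ fst c $ p else 0)
        else 0
   | (Inr q, t) \<Rightarrow> if snd c = t then B $ fst c $ q else 0)"

lemma wide_recurrence_mul:
  "(wide_recurrence e d E A B *v w) $ (Inl p, t) =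
     (if Suc (e t) < CARD('l)
      then (transpose E *v (\<chi> i. w $ (i, d (Suc (e t))))) $ p - (transpose A *v (\<chi> i. w $ (i, t))) $ p
      else 0)"
  "(wide_recurrence e d E A B *v w) $ (Inr q, t) = (transpose B *v (\<chi> i. w $ (i, t))) $ q"
  for E :: "('k::field, 'l::finite, 'n::finite) matrix"
  by (simp_all add: wide_recurrence_def matrix_vector_mult_def transpose_def sum_pair left_diff_distrib
      sum_subtractf if_distrib[of "\<lambda>x. x * _"] del: transpose_matrix_vector cong: if_cong)

lemma map_matrix_wide_recurrence:
  "map_matrix to_complex (wide_recurrence e d E A B) =
   wide_recurrence e d (map_matrix to_complex E) (map_matrix to_complex A) (map_matrix to_complex B)"
  by (simp add: vec_eq_iff wide_recurrence_def split: prod.split sum.split)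

text \<open>Injectivity of the recurrence matrix, in terms of sequences. The horizon of
  \<open>CARD('l)\<close> steps suits the path witness, where zeros advance one position per step
  through \<open>CARD('l)\<close> positions.\<close>

definition wide_determined :: "('k::field, 'l::finite, 'n::finite) matrix \<Rightarrow> ('k, 'l, 'n) matrix
    \<Rightarrow> ('k, 'l, 'm::finite) matrix \<Rightarrow> bool" where
  "wide_determined E A B \<longleftrightarrow> (\<forall>w. (\<forall>t. Suc t < CARD('l) \<longrightarrow> transpose E *v w (Suc t) = transpose A *v w t) \<longrightarrow>
     (\<forall>t<CARD('l). transpose B *v w t = 0) \<longrightarrow> (\<forall>t<CARD('l). w t = 0))"

definition tall_determined :: "('k::field, 'l::finite, 'n::finite) matrix \<Rightarrow> ('k, 'l, 'n) matrix
    \<Rightarrow> ('k, 'l, 'm::finite) matrix \<Rightarrow> bool" where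
  "tall_determined E A B \<longleftrightarrow> (\<forall>x y.
     (\<forall>t. Suc t < CARD('l) \<longrightarrow> E *v x (Suc t) - A *v x t + B *v y t = 0) \<longrightarrow>
     (\<forall>t<CARD('l). x t = 0 \<and> (Suc t < CARD('l) \<longrightarrow> y t = 0)))"

lemma polynomial_function_If:
  "polynomial_function f \<Longrightarrow> polynomial_function g \<Longrightarrow> polynomial_function (\<lambda>v. if b then f v else g v)"
  by (cases b) simp_all

text \<open>Injectivity at \<open>v0\<close> spreads to all \<open>v\<close> with
  \<open>p v \<noteq> 0\<close>. There it controls every finite \<open>z\<close> and also
  \<open>[E, B]\<close>, which acts as the pencil at infinity.\<close>

lemma wide_recurrence_polynomial:
  fixes E A :: "'v::real_normed_vector \<Rightarrow> ('k::real_or_complex, 'l::finite, 'n::finite) matrix"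
    and B :: "'v \<Rightarrow> ('k, 'l, 'm::finite) matrix"
  assumes poly: "polynomial_function E" "polynomial_function A" "polynomial_function B"
    and rec: "wide_determined (E v0) (A v0) (B v0)"
  obtains p where "real_polynomial_function p" "p v0 \<noteq> 0"
    "\<And>v. p v \<noteq> 0 \<Longrightarrow>
      (E v, A v, B v) \<in> behavioural_stabilizable \<inter> completely_stabilizable \<inter> strongly_stabilizable"
proof -
  obtain e :: "'l \<Rightarrow> nat" and d where ed: "\<And>t. e t < CARD('l)" "\<And>k. k < CARD('l) \<Longrightarrow> e (d k) = k"
    "\<And>t. d (e t) = t"
    by (rule ex_enumeration[where 'a='l]) (rule that)
  define M where "M v = wide_recurrence e d (E v) (A v) (B v)" for v
  have "polynomial_function (\<lambda>v. M v $ r $ c)" for r c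
  proof -
    obtain j t where r: "r = (j, t)" by (cases r)
    show ?thesis
      by (cases j)
         (auto simp: M_def wide_recurrence_def r intro!: polynomial_function_If polynomial_function_diff polynomial_function_vec_nth poly)
  qed
  moreover have "w = 0" if "M v0 *v w = 0" for w
  proof -
    have zero: "(M v0 *v w) $ r = 0" for r
      using that by simp
    have "transpose (E v0) *v (\<chi> i. w $ (i, d (Suc t))) = transpose (A v0) *v (\<chi> i. w $ (i, d t))"
      if "Suc t < CARD('l)" for t
    proof -
      have "(transpose (E v0) *v (\<chi> i. w $ (i, d (Suc t)))) $ p = (transpose (A v0) *v (\<chi> i. w $ (i, d t))) $ p" for p
        using zero[of "(Inl p, d t)"] that ed(2)[of t]
        by (simp add: M_def wide_recurrence_mul del: transpose_matrix_vector)
      then show ?thesis by (simp add: vec_eq_iff del: transpose_matrix_vector)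
    qed
    moreover have "transpose (B v0) *v (\<chi> i. w $ (i, d t)) = 0" for t
      using zero[of "(Inr _, d t)"]
      by (simp add: M_def wide_recurrence_mul vec_eq_iff del: transpose_matrix_vector)
    ultimately have "(\<chi> i. w $ (i, d t)) = 0" if "t < CARD('l)" for t
      using rec[unfolded wide_determined_def, rule_format, of "\<lambda>t. \<chi> i. w $ (i, d t)" t] that by blast
    then have "(\<chi> i. w $ (i, d (e s))) = 0" for s
      using ed(1) by blast
    then show "w = 0"
      by (simp add: vec_eq_iff ed)
  qed
  ultimately obtain p where p: "real_polynomial_function p" "p v0 \<noteq> 0"
    "\<And>v x. p v \<noteq> 0 \<Longrightarrow> map_matrix to_complex (M v) *v x = 0 \<Longrightarrow> x = 0"
    using injective_matrix_polynomial[of M v0] by blast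
  have "(E v, A v, B v) \<in> behavioural_stabilizable \<inter> completely_stabilizable \<inter> strongly_stabilizable"
    if v: "p v \<noteq> 0" for v
  proof (rule stabilizable_wide)
    fix z w assume "transpose (complex_pencil z (E v) (A v) (B v)) *v w = 0"
    then have zero: "z *s (transpose (map_matrix to_complex (E v)) *v w) = transpose (map_matrix to_complex (A v)) *v w"
      "transpose (map_matrix to_complex (B v)) *v w = 0"
      unfolding complex_pencil_def transpose_hcat_mul_eq_0_iff
      by (simp_all only: transpose_pencil pencil_mul right_minus_eq)
    \<comment> \<open>The geometric sequence of \<open>w\<close>; its term at time 0 is
      \<open>w\<close> itself, even for \<open>z = 0\<close>.\<close>
    define W where "W = (\<chi> x. z ^ e (snd x) * w $ fst x)"
    have W: "(\<chi> i. W $ (i, t)) = z ^ e t *s w" for t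
      by (simp add: W_def vec_eq_iff)
    have "map_matrix to_complex (M v) *v W = 0"
    proof -
      have "(map_matrix to_complex (M v) *v W) $ (j, t) = 0" for j t
        by (cases j)
           (simp_all add: M_def map_matrix_wide_recurrence wide_recurrence_mul W ed zero(2)
             vec.scale mult_ac del: transpose_matrix_vector flip: zero(1))
      then show ?thesis by (simp add: vec_eq_iff)
    qed
    then have "W = 0" using p(3) v by blast
    then have "(\<chi> i. W $ (i, d 0)) = 0" by (simp add: vec_eq_iff)
    then show "w = 0"
      by (simp add: W ed)
  next
    fix w assume "transpose (hcat (E v) (B v)) *v w = 0"
    then have zero: "transpose (E v) *v w = 0" "transpose (B v) *v w = 0"
      by (simp_all only: transpose_hcat_mul_eq_0_iff)
    \<comment> \<open>The sequence for \<open>z\<close> at infinity: \<open>w\<close> at the final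
      time, 0 before. The final term meets only \<open>transpose E\<close> and
      \<open>transpose B\<close>, since no equation leads beyond it.\<close>
    define W where "W = (\<chi> x. if Suc (e (snd x)) = CARD('l) then w $ fst x else 0)"
    have W: "(\<chi> i. W $ (i, t)) = (if Suc (e t) = CARD('l) then w else 0)" for t
      by (simp add: W_def vec_eq_iff)
    have "M v *v W = 0"
    proof -
      have "(M v *v W) $ (j, t) = 0" for j t
        using zero by (cases j) (simp_all add: M_def wide_recurrence_mul W del: transpose_matrix_vector)
      then show ?thesis by (simp add: vec_eq_iff)
    qed
    then have "W = 0"
      using kernel_of_complexification[of "M v" W] p(3) v by blast
    then have "(\<chi> i. W $ (i, d (CARD('l) - 1))) = 0" by (simp add: vec_eq_iff)
    then show "w = 0"
      by (simp add: W ed)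
  qed
  with p(1,2) that show ?thesis by blast
qed

text \<open>
  In the tall case the recurrence is \<open>E x\<^sub>t\<^sub>+\<^sub>1 - A x\<^sub>t + B y\<^sub>t = 0\<close>; the value of \<open>y\<close> at the final
  time is not involved and is set to zero by the additional rows.
\<close>

definition tall_recurrence :: "('l::finite \<Rightarrow> nat) \<Rightarrow> (nat \<Rightarrow> 'l)
    \<Rightarrow> ('k::field, 'l, 'n::finite) matrix \<Rightarrow> ('k, 'l, 'n) matrix \<Rightarrow> ('k, 'l, 'm::finite) matrix
    \<Rightarrow> 'k ^ (('n + 'm) \<times> 'l) ^ (('l + 'm) \<times> 'l)" where
  "tall_recurrence e d E A B = (\<chi> r c. case r of
     (Inl i, t) \<Rightarrow> if Suc (e t) < CARD('l)
        then (case fst c of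
           Inl p \<Rightarrow> (if snd c = d (Suc (e t)) then E $ i $ p else 0) - (if snd c = t then A $ i $ p else 0)
         | Inr q \<Rightarrow> if snd c = t then B $ i $ q else 0)
        else 0
   | (Inr q, t) \<Rightarrow> if Suc (e t) < CARD('l) then 0
        else if snd c = t then if fst c = Inr q then 1 else 0 else 0)"

lemma tall_recurrence_mul:
  "(tall_recurrence e d E A B *v w) $ (Inl i, t) =
     (if Suc (e t) < CARD('l)
      then (E *v (\<chi> p. w $ (Inl p, d (Suc (e t))))) $ i - (A *v (\<chi> p. w $ (Inl p, t))) $ i
        + (B *v (\<chi> q. w $ (Inr q, t))) $ i
      else 0)"
  "(tall_recurrence e d E A B *v w) $ (Inr q, t) = (if Suc (e t) < CARD('l) then 0 else w $ (Inr q, t))"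
  for E :: "('k::field, 'l::finite, 'n::finite) matrix"
  by (simp_all add: tall_recurrence_def matrix_vector_mult_def sum_pair sum_Plus left_diff_distrib
      sum_subtractf if_distrib[of "\<lambda>x. x * _"] cong: if_cong)

lemma map_matrix_tall_recurrence:
  "map_matrix to_complex (tall_recurrence e d E A B) =
   tall_recurrence e d (map_matrix to_complex E) (map_matrix to_complex A) (map_matrix to_complex B)"
  by (simp add: vec_eq_iff tall_recurrence_def split: prod.split sum.split)

lemma tall_recurrence_polynomial:
  fixes E A :: "'v::real_normed_vector \<Rightarrow> ('k::real_or_complex, 'l::finite, 'n::finite) matrix"
    and B :: "'v \<Rightarrow> ('k, 'l, 'm::finite) matrix"
  assumes poly: "polynomial_function E" "polynomial_function A" "polynomial_function B"
    and card: "1 < CARD('l)"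
    and rec: "tall_determined (E v0) (A v0) (B v0)"
  obtains p where "real_polynomial_function p" "p v0 \<noteq> 0"
    "\<And>v. p v \<noteq> 0 \<Longrightarrow> (E v, A v, B v) \<in> behavioural_stabilizable"
proof -
  obtain e :: "'l \<Rightarrow> nat" and d where ed: "\<And>t. e t < CARD('l)" "\<And>k. k < CARD('l) \<Longrightarrow> e (d k) = k"
    "\<And>t. d (e t) = t"
    by (rule ex_enumeration[where 'a='l]) (rule that)
  define M where "M v = tall_recurrence e d (E v) (A v) (B v)" for v
  have "polynomial_function (\<lambda>v. M v $ r $ c)" for r c
  proof -
    obtain j t where r: "r = (j, t)" by (cases r)
    obtain k s where c: "c = (k, s)" by (cases c)
    show ?thesis
      by (cases j; cases k)
         (auto simp: M_def tall_recurrence_def r c intro!: polynomial_function_If polynomial_function_diff polynomial_function_vec_nth poly)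
  qed
  moreover have "w = 0" if w: "M v0 *v w = 0" for w
  proof -
    define x where "x t = (\<chi> p. w $ (Inl p, d t))" for t
    define y where "y t = (\<chi> q. w $ (Inr q, d t))" for t
    have zero: "(M v0 *v w) $ r = 0" for r
      using w by simp
    have "E v0 *v x (Suc t) - A v0 *v x t + B v0 *v y t = 0" if "Suc t < CARD('l)" for t
    proof -
      have "(E v0 *v x (Suc t) - A v0 *v x t + B v0 *v y t) $ i = 0" for i
        using zero[of "(Inl i, d t)"] that ed(2)[of t]
        by (simp add: M_def tall_recurrence_mul x_def y_def)
      then show ?thesis by (simp add: vec_eq_iff)
    qed
    then have xy: "x t = 0 \<and> (Suc t < CARD('l) \<longrightarrow> y t = 0)" if "t < CARD('l)" for t
      using rec[unfolded tall_determined_def, rule_format, of x y t] that by blast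
    have y: "w $ (Inr q, s) = 0" for q s
    proof (cases "Suc (e s) < CARD('l)")
      case True
      then have "y (e s) = 0" using xy[of "e s"] by simp
      then show ?thesis by (simp add: y_def vec_eq_iff ed)
    next
      case False
      moreover have "(M v0 *v w) $ (Inr q, s) = 0" using w by simp
      ultimately show ?thesis
        unfolding M_def tall_recurrence_mul by simp
    qed
    have x: "w $ (Inl p, s) = 0" for p s
    proof -
      have "x (e s) = 0" using xy[of "e s"] ed by blast
      then show ?thesis by (simp add: x_def vec_eq_iff ed)
    qed
    show "w = 0"
      using x y by (simp add: vec_eq_iff split_sum_all)
  qed
  ultimately obtain p where p: "real_polynomial_function p" "p v0 \<noteq> 0"
    "\<And>v x. p v \<noteq> 0 \<Longrightarrow> map_matrix to_complex (M v) *v x = 0 \<Longrightarrow> x = 0"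
    using injective_matrix_polynomial[of M v0] by blast
  have "(E v, A v, B v) \<in> behavioural_stabilizable" if v: "p v \<noteq> 0" for v
  proof (rule behavioural_stabilizable_tall)
    fix z u assume "complex_pencil z (E v) (A v) (B v) *v u = 0"
    define x where "x = (\<chi> p. u $ Inl p)"
    define y where "y = (\<chi> q. u $ Inr q)"
    have zero: "z *s (map_matrix to_complex (E v) *v x) - map_matrix to_complex (A v) *v x
        + map_matrix to_complex (B v) *v y = 0"
      using \<open>complex_pencil z (E v) (A v) (B v) *v u = 0\<close>
      by (simp add: complex_pencil_def hcat_mul pencil_mul x_def y_def)
    \<comment> \<open>Geometric in both parts, except that the \<open>y\<close> part at the final
      time is 0, as the additional rows demand.\<close>
    define W where "W = (\<chi> c. if Suc (e (snd c)) < CARD('l) \<or> (\<exists>p. fst c = Inl p) then z ^ e (snd c) * u $ fst c else 0)"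
    have W: "(\<chi> p. W $ (Inl p, t)) = z ^ e t *s x"
      "(\<chi> q. W $ (Inr q, t)) = (if Suc (e t) < CARD('l) then z ^ e t *s y else 0)" for t
      by (simp_all add: W_def x_def y_def vec_eq_iff)
    have "map_matrix to_complex (M v) *v W = 0"
    proof -
      have "(map_matrix to_complex (M v) *v W) $ (j, t) = 0" for j t
      proof (cases j)
        case (Inl i)
        have "(z ^ e t *s (z *s (map_matrix to_complex (E v) *v x) - map_matrix to_complex (A v) *v x
          + map_matrix to_complex (B v) *v y)) $ i = 0"
          unfolding zero by simp
        then show ?thesis
          by (simp add: Inl M_def map_matrix_tall_recurrence tall_recurrence_mul W ed vec.scale algebra_simps)
      next
        case (Inr q)
        then show ?thesis
          by (simp add: M_def map_matrix_tall_recurrence tall_recurrence_mul) (simp add: W_def)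
      qed
      then show ?thesis by (simp add: vec_eq_iff)
    qed
    then have "W = 0" using p(3) v by blast
    then have "W $ (j, d 0) = 0" for j by simp
    \<comment> \<open>By \<open>card\<close>, time 0 is not the final time, so the entries there
      still contain \<open>y\<close>.\<close>
    then show "u = 0"
      using card by (simp add: W_def ed vec_eq_iff)
  qed
  with p(1,2) that show ?thesis by blast
qed

section \<open>Witnesses\<close>

text \<open>Solved for \<open>u t (Suc k)\<close>, the recurrence carries the zeros at
  \<open>k = 0\<close> to the right at the cost of one time step per position, which clears the
  triangle \<open>t + k < L\<close>. Its edge \<open>t = 0\<close> is a zero initial state, and from
  there the recurrence is run forward in time.\<close>

lemma path_recurrence:
  fixes u :: "nat \<Rightarrow> nat \<Rightarrow> 'a::ab_group_add"
  assumes step: "\<And>t k. Suc t < L \<Longrightarrow> k < N \<Longrightarrow>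
      u (Suc t) k = (case k of 0 \<Rightarrow> 0 | Suc j \<Rightarrow> u t j) - u t (Suc k)"
    and start: "\<And>t. t < L \<Longrightarrow> u t 0 = 0"
    and outside: "\<And>t k. t < L \<Longrightarrow> N \<le> k \<or> L \<le> k \<Longrightarrow> u t k = 0"
    and "t < L"
  shows "u t k = 0"
proof -
  have near: "t + k < L \<Longrightarrow> k \<le> N \<Longrightarrow> u t k = 0" for t k
  proof (induction k arbitrary: t rule: less_induct)
    case (less k)
    show ?case
    proof (cases k)
      case 0
      then show ?thesis using start less.prems by simp
    next
      case (Suc j)
      have "u (Suc t) j = (case j of 0 \<Rightarrow> 0 | Suc i \<Rightarrow> u t i) - u t k"
        using step[of t j] less.prems Suc by simp
      moreover have "u (Suc t) j = 0"
        using less.IH[of j "Suc t"] less.prems Suc by simp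
      moreover have "(case j of 0 \<Rightarrow> 0 | Suc i \<Rightarrow> u t i) = 0"
        using less.IH[of "j - 1" t] less.prems Suc by (cases j) auto
      ultimately show ?thesis by simp
    qed
  qed
  have "t < L \<Longrightarrow> u t k = 0" for k
  proof (induction t arbitrary: k)
    case 0
    then show ?case using near[of 0 k] outside[of 0 k] by (cases "k < L \<and> k \<le> N") auto
  next
    case (Suc t)
    show ?case
    proof (cases "k < N")
      case True
      then show ?thesis
        using step[of t k] Suc.IH Suc.prems by (cases k) auto
    next
      case False
      then show ?thesis using outside[of "Suc t" k] Suc.prems by auto
    qed
  qed
  then show ?thesis using \<open>t < L\<close> by blast
qed

text \<open>A vector as a function on all path positions, extended by 0, so that the missing
  neighbour of the last position needs no special case.\<close>

definition value_at :: "('l::finite \<Rightarrow> nat) \<Rightarrow> 'a::comm_monoid_add ^ 'l \<Rightarrow> nat \<Rightarrow> 'a" where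
  "value_at e w k = (\<Sum>i\<in>UNIV. if e i = k then w $ i else 0)"

text \<open>For injective \<open>e\<close>, column \<open>p\<close> is the unit vector at position
  \<open>f p\<close>, or zero if that position lies beyond the last row.\<close>

definition placement :: "('l::finite \<Rightarrow> nat) \<Rightarrow> ('n::finite \<Rightarrow> nat) \<Rightarrow> ('k::real_or_complex, 'l, 'n) matrix" where
  "placement e f = (\<chi> i p. if e i = f p then 1 else 0)"

text \<open>The skew adjacency matrix of a path, a central difference operator; its entries are
  real, so it is admissible over both fields.\<close>

definition path_matrix :: "('l::finite \<Rightarrow> nat) \<Rightarrow> ('k::real_or_complex, 'l, 'l) matrix" where
  "path_matrix e = (\<chi> i j. (if e i = Suc (e j) then 1 else 0) - (if e j = Suc (e i) then 1 else 0))"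

lemma value_at_index: "inj e \<Longrightarrow> value_at e w (e i) = w $ i"
  by (simp add: value_at_def inj_eq)

lemma value_at_outside: "(\<And>i. e i \<noteq> k) \<Longrightarrow> value_at e w k = 0"
  by (simp add: value_at_def)

lemma transpose_placement_mul: "(transpose (placement e f) *v w) $ p = value_at e w (f p)"
  by (simp add: placement_def value_at_def matrix_vector_mult_def transpose_def
      if_distrib[of "\<lambda>x. x * _"] del: transpose_matrix_vector cong: if_cong)

lemma placement_mul: "(placement e f *v x) $ i = (\<Sum>p\<in>UNIV. if e i = f p then x $ p else 0)"
  by (simp add: placement_def matrix_vector_mult_def if_distrib[of "\<lambda>x. x * _"] cong: if_cong)

lemma placement_mul_index: "inj f \<Longrightarrow> e i = f p \<Longrightarrow> (placement e f *v x) $ i = x $ p"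
  by (simp add: placement_mul inj_eq)

lemma placement_mul_outside: "(\<And>p. e i \<noteq> f p) \<Longrightarrow> (placement e f *v x) $ i = 0"
  by (simp add: placement_mul)

lemma path_matrix_mul:
  "(path_matrix e *v w) $ i =
     (case e i of 0 \<Rightarrow> 0 | Suc k \<Rightarrow> value_at e w k) - value_at e w (Suc (e i))"
proof -
  have "(path_matrix e *v w) $ i = (\<Sum>j\<in>UNIV. if e i = Suc (e j) then w $ j else 0) - value_at e w (Suc (e i))"
    by (simp add: path_matrix_def value_at_def matrix_vector_mult_def left_diff_distrib sum_subtractf
        if_distrib[of "\<lambda>x. x * _"] cong: if_cong)
  also have "(\<Sum>j\<in>UNIV. if e i = Suc (e j) then w $ j else 0) =
      (case e i of 0 \<Rightarrow> 0 | Suc k \<Rightarrow> value_at e w k)"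
    by (cases "e i") (auto simp: value_at_def intro!: sum.cong)
  finally show ?thesis .
qed

lemma adj_path_matrix: "adj (path_matrix e :: ('k::real_or_complex, 'l::finite, 'l) matrix) = - path_matrix e"
proof -
  have "kconj (x - y) = kconj x - kconj y" for x y :: 'k
    using kconj_simps(2)[of x "- y"] by simp
  then show ?thesis
    by (simp add: adj_def path_matrix_def vec_eq_iff if_distrib[of kconj])
qed

lemma transpose_path_matrix: "transpose (path_matrix e) = - path_matrix e"
  by (simp add: transpose_def path_matrix_def vec_eq_iff)

lemma wide_witness:
  assumes "CARD('l::finite) < CARD('n::finite) + CARD('m::finite)"
  obtains E :: "('k::real_or_complex, 'l::finite, 'n::finite) matrix" and J and B :: "('k, 'l, 'm::finite) matrix"
  where "J = - adj J"
    "wide_determined E (J ** E) B"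
proof -
  let ?l = "CARD('l)" and ?n = "CARD('n)" and ?m = "CARD('m)"
  obtain e :: "'l \<Rightarrow> nat" and d where e: "\<And>i. e i < ?l" "\<And>k. k < ?l \<Longrightarrow> e (d k) = k"
    "\<And>i. d (e i) = i" by (rule ex_enumeration[where 'a='l]) (rule that)
  obtain b :: "'n \<Rightarrow> nat" and b' where b: "\<And>p. b p < ?n" "\<And>k. k < ?n \<Longrightarrow> b (b' k) = k"
    "\<And>p. b' (b p) = p" by (rule ex_enumeration[where 'a='n]) (rule that)
  obtain c :: "'m \<Rightarrow> nat" and c' where c: "\<And>q. c q < ?m" "\<And>k. k < ?m \<Longrightarrow> c (c' k) = k"
    "\<And>q. c' (c q) = q" by (rule ex_enumeration[where 'a='m]) (rule that)
  have inj: "inj e" by (rule inj_on_inverseI[of _ d]) (rule e(3))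
  \<comment> \<open>\<open>E\<close> takes the positions \<open>0\<close> to \<open>n - 1\<close>.
    The first column of \<open>B\<close> goes to position 0 to make the boundary value vanish; the
    others start at position \<open>n\<close>, hence the offset \<open>n - 1\<close>. The last
    position reached is \<open>n + m - 2\<close>, which covers all rows because
    \<open>l < n + m\<close>.\<close>
  define f where "f q = (if c q = 0 then 0 else ?n - 1 + c q)" for q
  define E :: "('k, 'l, 'n) matrix" where "E = placement e b"
  define B :: "('k, 'l, 'm) matrix" where "B = placement e f"
  \<comment> \<open>Transposition undoes the sign, so \<open>path_matrix e\<close> itself drives the
    recurrence for left kernel vectors.\<close>
  define J :: "('k, 'l, 'l) matrix" where "J = - path_matrix e"
  have "adj J = - J" by (simp add: J_def adj_path_matrix)
  then have "J = - adj J" by (rule skew_iff[THEN iffD2])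
  moreover have "w t = 0"
    if rec: "\<And>t. Suc t < ?l \<Longrightarrow> transpose E *v w (Suc t) = transpose (J ** E) *v w t"
      and zero: "\<And>t. t < ?l \<Longrightarrow> transpose B *v w t = 0" and t: "t < ?l" for w t
  proof -
    define u where "u t k = value_at e (w t) k" for t k
    have "transpose (J ** E) *v w t = transpose E *v (path_matrix e *v w t)" for t
      by (simp only: J_def matrix_transpose_mul matrix_vector_mul_assoc[symmetric])
         (simp add: transpose_path_matrix transpose_def vec_eq_iff path_matrix_def del: transpose_matrix_vector)
    then have shift: "u (Suc t) (b p) = value_at e (path_matrix e *v w t) (b p)" if "Suc t < ?l" for t p
      using arg_cong[OF rec[OF that], of "\<lambda>x. x $ p"]
      by (simp only: E_def transpose_placement_mul u_def)
    have u0: "u t (f q) = 0" if "t < ?l" for t q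
      using arg_cong[OF zero[OF that], of "\<lambda>x. x $ q"]
      by (simp only: B_def transpose_placement_mul u_def zero_index)
    have "u t k = 0" for k
    \<comment> \<open>\<open>E\<close> covers the positions below \<open>n\<close>, of which only
      those below \<open>l\<close> exist.\<close>
    proof (rule path_recurrence[where L = ?l and N = "min ?n ?l"])
      fix t k assume tk: "Suc t < ?l" "k < min ?n ?l"
      have "u (Suc t) k = value_at e (path_matrix e *v w t) k"
        using shift[of t "b' k"] tk b by simp
      also have "\<dots> = (path_matrix e *v w t) $ d k"
        using value_at_index[OF inj, of "path_matrix e *v w t" "d k"] e(2)[of k] tk by simp
      finally show "u (Suc t) k = (case k of 0 \<Rightarrow> 0 | Suc j \<Rightarrow> u t j) - u t (Suc k)"
        using tk e(2)[of k] by (cases k) (simp_all add: path_matrix_mul u_def)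
    next
      fix t assume "t < ?l"
      then show "u t 0 = 0"
        using u0[of t "c' 0"] c by (simp add: f_def)
    next
      fix t k assume t: "t < ?l" and k: "min ?n ?l \<le> k \<or> ?l \<le> k"
      show "u t k = 0"
      proof (cases "k < ?l")
        case True
        with k have "?n \<le> k" by auto
        moreover have "0 < ?n" by simp
        ultimately have "f (c' (Suc (k - ?n))) = k"
          using c(2)[of "Suc (k - ?n)"] True assms unfolding f_def by (simp only: nat.simps if_False)
        then show ?thesis using u0[OF t, of "c' (Suc (k - ?n))"] by simp
      next
        case False
        then show ?thesis unfolding u_def by (intro value_at_outside) (use e(1) in \<open>metis\<close>)
      qed
    qed (rule t)
    then have "u t (e i) = 0" for i by blast
    then show "w t = 0"
      by (simp add: u_def value_at_index[OF inj] vec_eq_iff)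
  qed
  then have "wide_determined E (J ** E) B"
    unfolding wide_determined_def by blast
  ultimately show ?thesis by (rule that)
qed

lemma tall_witness:
  assumes "CARD('n::finite) + CARD('m::finite) < CARD('l::finite)"
  obtains E :: "('k::real_or_complex, 'l::finite, 'n::finite) matrix" and J and B :: "('k, 'l, 'm::finite) matrix"
  where "J = - adj J"
    "tall_determined E (J ** E) B"
proof -
  let ?l = "CARD('l)" and ?n = "CARD('n)" and ?m = "CARD('m)"
  obtain e :: "'l \<Rightarrow> nat" and d where e: "\<And>i. e i < ?l" "\<And>k. k < ?l \<Longrightarrow> e (d k) = k"
    "\<And>i. d (e i) = i" by (rule ex_enumeration[where 'a='l]) (rule that)
  obtain b :: "'n \<Rightarrow> nat" and b' where b: "\<And>p. b p < ?n" "\<And>k. k < ?n \<Longrightarrow> b (b' k) = k"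
    "\<And>p. b' (b p) = p" by (rule ex_enumeration[where 'a='n]) (rule that)
  obtain c :: "'m \<Rightarrow> nat" and c' where c: "\<And>q. c q < ?m" "\<And>k. k < ?m \<Longrightarrow> c (c' k) = k"
    "\<And>q. c' (c q) = q" by (rule ex_enumeration[where 'a='m]) (rule that)
  have inj: "inj e" by (rule inj_on_inverseI[of _ d]) (rule e(3))
  \<comment> \<open>Position 0 is left free of \<open>E\<close> and \<open>B\<close>, which makes
    the boundary value vanish; \<open>E\<close> takes \<open>1\<close> to \<open>n\<close> and
    \<open>B\<close> the next \<open>m\<close> positions. This requires \<open>n + m + 1\<close>
    rows.\<close>
  define f where "f p = Suc (b p)" for p
  define g where "g q = Suc ?n + c q" for q
  have injf: "inj f" by (rule inj_on_inverseI[of _ "\<lambda>k. b' (k - 1)"]) (simp add: f_def b)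
  have injg: "inj g" by (rule inj_on_inverseI[of _ "\<lambda>k. c' (k - Suc ?n)"]) (simp add: g_def c)
  define E :: "('k, 'l, 'n) matrix" where "E = placement e f"
  define B :: "('k, 'l, 'm) matrix" where "B = placement e g"
  define J :: "('k, 'l, 'l) matrix" where "J = path_matrix e"
  have "J = - adj J" by (simp add: J_def adj_path_matrix)
  moreover have "x t = 0 \<and> (Suc t < ?l \<longrightarrow> y t = 0)"
    if rec: "\<And>t. Suc t < ?l \<Longrightarrow> E *v x (Suc t) - (J ** E) *v x t + B *v y t = 0" and t: "t < ?l" for x y t
  proof -
    \<comment> \<open>The unknown is \<open>E *v x t\<close>, on which \<open>path_matrix e\<close>
      acts directly. The rows \<open>0\<close> to \<open>n\<close> contain no \<open>B\<close> and
      form the path recurrence; afterwards \<open>B *v y t = 0\<close> remains.\<close>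
    define u where "u t k = value_at e (E *v x t) k" for t k
    have E0: "(E *v x t) $ i = 0" if "e i = 0 \<or> Suc ?n \<le> e i" for t i
      unfolding E_def using that b(1) by (intro placement_mul_outside) (force simp: f_def dest: leD)
    have B0: "(B *v y t) $ i = 0" if "e i < Suc ?n" for t i
      unfolding B_def using that by (intro placement_mul_outside) (auto simp: g_def)
    have rec_i: "(E *v x (Suc t)) $ i - (path_matrix e *v (E *v x t)) $ i + (B *v y t) $ i = 0"
      if "Suc t < ?l" for t i
      using arg_cong[OF rec[OF that], of "\<lambda>x. x $ i"]
      by (simp add: J_def matrix_vector_mul_assoc)
    have u: "u t k = 0" if "t < ?l" for t k
    proof (rule path_recurrence[where L = ?l and N = "Suc ?n"])
      fix t k assume tk: "Suc t < ?l" "k < Suc ?n"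
      then have k: "k < ?l" using assms by simp
      have "(E *v x (Suc t)) $ d k = (path_matrix e *v (E *v x t)) $ d k"
        using rec_i[OF tk(1), of "d k"] B0[of "d k" t] tk(2) k e(2) by simp
      moreover have "u (Suc t) k = (E *v x (Suc t)) $ d k"
        using value_at_index[OF inj, of "E *v x (Suc t)" "d k"] k e(2) by (simp add: u_def)
      ultimately show "u (Suc t) k = (case k of 0 \<Rightarrow> 0 | Suc j \<Rightarrow> u t j) - u t (Suc k)"
        using k e(2)[of k] by (cases k) (simp_all add: path_matrix_mul u_def)
    next
      fix t
      show "u t 0 = 0"
        using value_at_index[OF inj, of "E *v x t" "d 0"] E0[of "d 0"] e(2)[of 0] by (simp add: u_def)
    next
      fix t k assume "Suc ?n \<le> k \<or> ?l \<le> k"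
      then have k: "Suc ?n \<le> k" using assms by auto
      show "u t k = 0"
      proof (cases "k < ?l")
        case True
        then show ?thesis
          using value_at_index[OF inj, of "E *v x t" "d k"] E0[of "d k"] e(2)[of k] k by (simp add: u_def)
      next
        case False
        then show ?thesis unfolding u_def by (intro value_at_outside) (use e(1) in \<open>metis\<close>)
      qed
    qed (rule that)
    have Ex: "E *v x t = 0" if "t < ?l" for t
      using u[OF that, of "e _"] by (simp add: u_def value_at_index[OF inj] vec_eq_iff)
    have "x t $ p = 0" for p
    proof -
      have "f p < ?l" using b(1)[of p] assms by (simp add: f_def)
      then have "(E *v x t) $ d (f p) = x t $ p"
        unfolding E_def by (intro placement_mul_index injf e(2))
      then show ?thesis using Ex[OF t] by simp
    qed
    moreover have "y t $ q = 0" if "Suc t < ?l" for q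
    proof -
      have "g q < ?l" using c(1)[of q] assms by (simp add: g_def)
      then have "(B *v y t) $ d (g q) = y t $ q"
        unfolding B_def by (intro placement_mul_index injg e(2))
      moreover have "B *v y t = 0"
        using rec[OF that] Ex[OF t] Ex[OF that] by (simp flip: matrix_vector_mul_assoc)
      ultimately show ?thesis by simp
    qed
    ultimately show ?thesis by (simp add: vec_eq_iff)
  qed
  then have "tall_determined E (J ** E) B"
    unfolding tall_determined_def by blast
  ultimately show ?thesis by (rule that)
qed

section \<open>The square case\<close>

text \<open>If \<open>f v\<close> had no zero in the disc, the maximum principle for \<open>1 / f v\<close> would bound \<open>f v z0\<close>
  from below by its values on the circle.\<close>

lemma persistent_zero:
  fixes f :: "'v::euclidean_space \<Rightarrow> complex \<Rightarrow> complex"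
  assumes cont: "continuous_on UNIV (\<lambda>x. f (snd x) (fst x))"
    and hol: "\<And>v. f v holomorphic_on UNIV"
    and r: "0 < r" and root: "f v0 z0 = 0" and nz: "\<And>z. z \<in> sphere z0 r \<Longrightarrow> f v0 z \<noteq> 0"
  obtains U where "open U" "v0 \<in> U" "\<And>v. v \<in> U \<Longrightarrow> \<exists>z\<in>ball z0 r. f v z = 0"
    "\<And>v z. v \<in> U \<Longrightarrow> z \<in> sphere z0 r \<Longrightarrow> f v z \<noteq> 0"
proof -
  have cont_z: "continuous_on S (f v)" for S v
    using hol holomorphic_on_imp_continuous_on continuous_on_subset by blast
  have cont_v: "continuous_on UNIV (\<lambda>v. f v z)" for z
    using continuous_on_compose2[OF cont, of UNIV "\<lambda>v. (z, v)"] by (simp add: continuous_intros)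
  have "compact ((\<lambda>z. norm (f v0 z)) ` sphere z0 r)"
    by (intro compact_continuous_image continuous_intros cont_z) auto
  moreover have "sphere z0 r \<noteq> {}" using r by simp
  ultimately obtain s where s: "s \<in> sphere z0 r" "\<And>z. z \<in> sphere z0 r \<Longrightarrow> norm (f v0 s) \<le> norm (f v0 z)"
    using compact_attains_inf[of "(\<lambda>z. norm (f v0 z)) ` sphere z0 r"] by (auto simp: image_iff)
  \<comment> \<open>Half the minimum leaves a strict inequality on the circle that survives a
    perturbation of \<open>v0\<close>.\<close>
  define c where "c = norm (f v0 s) / 2"
  have c: "0 < c" using nz[OF s(1)] by (simp add: c_def)
  define T where "T = {x :: complex \<times> 'v. norm (f (snd x) (fst x)) \<le> c}"
  have "closed T"
    unfolding T_def by (intro closed_Collect_le continuous_intros cont)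
  \<comment> \<open>Projection along the compact circle is closed, which makes the lower bound hold
    for all points of the circle at once when \<open>v\<close> is near \<open>v0\<close>.\<close>
  then have "closed {v. \<exists>z. z \<in> sphere z0 r \<and> (z, v) \<in> T}"
    by (intro closed_compact_projection) simp_all
  moreover have "open {v. norm (f v z0) < c}"
    by (intro open_Collect_less continuous_intros cont_v)
  ultimately have "open (- {v. \<exists>z. z \<in> sphere z0 r \<and> (z, v) \<in> T} \<inter> {v. norm (f v z0) < c})" (is "open ?U")
    by (intro open_Int open_Compl)
  moreover have "v0 \<in> ?U"
  proof -
    have "c < norm (f v0 z)" if "z \<in> sphere z0 r" for z
      using s(2)[OF that] c unfolding c_def by linarith
    then show ?thesis using c root by (fastforce simp: T_def)
  qed
  moreover have large: "c < norm (f v z)" if "v \<in> ?U" "z \<in> sphere z0 r" for v z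
    using that by (force simp: T_def)
  moreover have "\<exists>z\<in>ball z0 r. f v z = 0" if v: "v \<in> ?U" for v
  proof (rule ccontr)
    assume no: "\<not> (\<exists>z\<in>ball z0 r. f v z = 0)"
    have nonzero: "f v z \<noteq> 0" if "z \<in> cball z0 r" for z
    proof (cases "z \<in> sphere z0 r")
      case True
      then show ?thesis using large[OF v] c by fastforce
    next
      case False
      with that have "z \<in> ball z0 r" by auto
      then show ?thesis using no by blast
    qed
    have "norm (inverse (f v z0)) \<le> inverse c"
    proof (rule maximum_modulus_frontier[of "\<lambda>z. inverse (f v z)" "cball z0 r"])
      show "(\<lambda>z. inverse (f v z)) holomorphic_on interior (cball z0 r)"
        using nonzero by (intro holomorphic_on_inverse holomorphic_on_subset[OF hol]) auto
      show "continuous_on (closure (cball z0 r)) (\<lambda>z. inverse (f v z))"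
        using nonzero by (intro continuous_on_inverse cont_z) auto
      show "norm (inverse (f v z)) \<le> inverse c" if "z \<in> frontier (cball z0 r)" for z
        using large[OF v, of z] that c r by (simp add: norm_inverse le_imp_inverse_le)
    qed (use r in auto)
    moreover have "norm (f v z0) < c" "f v z0 \<noteq> 0"
      using v nonzero[of z0] r by auto
    ultimately show False
      using c by (simp add: norm_inverse)
  qed
  moreover have "f v z \<noteq> 0" if "v \<in> ?U" "z \<in> sphere z0 r" for v z
    using large[OF that] c by auto
  ultimately show ?thesis by (intro that[of ?U])
qed

lemma square_rank_drop:
  fixes E A :: "'v::euclidean_space \<Rightarrow> ('k::real_or_complex, 'l::finite, 'n::finite) matrix"
    and B :: "'v \<Rightarrow> ('k, 'l, 'm::finite) matrix"
    and b :: "'l \<Rightarrow> 'n + 'm" and p0 :: 'n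
  assumes poly: "polynomial_function E" "polynomial_function A" "polynomial_function B"
    and b: "bij b"
    and E0: "E v0 = (\<chi> i j. if b i = Inl j then 1 else 0)"
    and A0: "A v0 = (\<chi> i j. if b i = Inl p0 \<and> j = p0 then 1 else 0)"
    and B0: "B v0 = (\<chi> i j. if b i = Inr j then 1 else 0)"
  obtains U where "open U" "v0 \<in> U"
    "\<And>v. v \<in> U \<Longrightarrow>
      (E v, A v, B v) \<notin> behavioural_stabilizable \<union> completely_stabilizable \<union> strongly_stabilizable"
proof -
  \<comment> \<open>Relabelling the columns by \<open>b\<close> gives rows and columns one index
    type, so that a determinant exists.\<close>
  define g where "g v z = (\<chi> i i'. complex_pencil z (E v) (A v) (B v) $ i $ b i')" for v z
  define f where "f v z = det (g v z)" for v z
  have kernel: "f v z \<noteq> 0 \<longleftrightarrow> rank_pencil_at z (E v) (A v) (B v) = CARD('n + 'm)" for v z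
  proof -
    have mul: "g v z *v x = complex_pencil z (E v) (A v) (B v) *v (\<chi> j. x $ inv b j)" for x
      by (simp add: vec_eq_iff g_def matrix_vector_mult_def)
         (intro allI sum.reindex_bij_betw[of b UNIV UNIV "\<lambda>j. _ $ _ $ j * _ $ inv b j", simplified, THEN trans[rotated]],
          simp_all add: b inv_f_f bij_is_inj)
    have "f v z \<noteq> 0 \<longleftrightarrow> (\<forall>x. g v z *v x = 0 \<longrightarrow> x = 0)"
      by (simp only: f_def flip: invertible_det_nz) (simp only: invertible_left_inverse matrix_left_invertible_ker)
    also have "\<dots> \<longleftrightarrow> (\<forall>y. complex_pencil z (E v) (A v) (B v) *v y = 0 \<longrightarrow> y = 0)"
    proof safe
      fix y assume *: "\<forall>x. g v z *v x = 0 \<longrightarrow> x = 0" "complex_pencil z (E v) (A v) (B v) *v y = 0"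
      have "(\<chi> j. (\<chi> i. y $ b i) $ inv b j) = y"
        using b by (simp add: vec_eq_iff bij_is_surj surj_f_inv_f)
      then have "(\<chi> i. y $ b i) = 0" using * mul by metis
      then have "y $ b (inv b j) = 0" for j by (simp add: vec_eq_iff)
      then show "y = 0" using b by (simp add: vec_eq_iff bij_is_surj surj_f_inv_f)
    next
      fix x assume *: "\<forall>y. complex_pencil z (E v) (A v) (B v) *v y = 0 \<longrightarrow> y = 0" "g v z *v x = 0"
      then have "(\<chi> j. x $ inv b j) = 0" using mul by metis
      then have "x $ inv b (b i) = 0" for i by (simp add: vec_eq_iff)
      then show "x = 0" using b by (simp add: vec_eq_iff bij_is_inj inv_f_f)
    qed
    finally show ?thesis
      by (simp only: rank_pencil_at_eq rank_eq_card_columns_iff)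
  qed
  \<comment> \<open>This product is \<open>(z - 1) * z ^ (n - 1)\<close>.\<close>
  have f0: "f v0 z = (\<Prod>i\<in>UNIV. case b i of Inl j \<Rightarrow> if j = p0 then z - 1 else z | Inr q \<Rightarrow> 1)" for z
  proof -
    have "g v0 z $ i $ i' = 0" if "i \<noteq> i'" for i i'
    proof -
      have "b i \<noteq> b i'" using that b by (simp add: bij_is_inj inj_eq)
      then show ?thesis
        by (cases "b i'") (auto simp: g_def complex_pencil_def hcat_def pencil_def E0 A0 B0)
    qed
    then have "f v0 z = (\<Prod>i\<in>UNIV. g v0 z $ i $ i)"
      unfolding f_def by (rule det_diagonal)
    also have "\<dots> = (\<Prod>i\<in>UNIV. case b i of Inl j \<Rightarrow> if j = p0 then z - 1 else z | Inr q \<Rightarrow> 1)"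
      by (intro prod.cong)
         (auto simp: g_def complex_pencil_def hcat_def pencil_def E0 A0 B0 split: sum.split)
    finally show ?thesis .
  qed
  have to_complex_cont: "continuous_on UNIV (\<lambda>x. to_complex (h (snd x)))" if "polynomial_function h"
    for h :: "'v \<Rightarrow> 'k"
    by (intro bounded_linear.continuous_on[OF bounded_linear_to_complex]
        continuous_on_compose2[OF continuous_on_polymonial_function[OF that, of UNIV]] continuous_intros) simp
  have "continuous_on UNIV (\<lambda>x. g (snd x) (fst x) $ i $ i')" for i i'
    by (cases "b i'")
       (simp_all add: g_def complex_pencil_def hcat_def pencil_def,
        (intro continuous_intros to_complex_cont polynomial_function_vec_nth poly)+)
  then have cont: "continuous_on UNIV (\<lambda>x. f (snd x) (fst x))"
    unfolding f_def det_def
    by (intro continuous_on_sum continuous_on_mult continuous_on_prod continuous_on_const)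
  have "(\<lambda>z. g v z $ i $ i') holomorphic_on UNIV" for v i i'
    by (cases "b i'")
       (simp_all add: g_def complex_pencil_def hcat_def pencil_def, (intro holomorphic_intros)+)
  then have hol: "f v holomorphic_on UNIV" for v
    unfolding f_def[abs_def] det_def
    by (intro holomorphic_on_sum holomorphic_on_mult holomorphic_on_prod holomorphic_on_const)
  have root: "f v0 1 = 0"
  proof -
    have "b (inv b (Inl p0)) = Inl p0" using b by (simp add: bij_is_surj surj_f_inv_f)
    then show ?thesis unfolding f0 by (intro prod_zero bexI[of _ "inv b (Inl p0)"]) simp_all
  qed
  \<comment> \<open>The radius 1/2 separates the zero 1 from the possible zero 0 and keeps the disc
    inside the right half-plane.\<close>
  have nz: "f v0 z \<noteq> 0" if "z \<in> sphere 1 (1/2)" for z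
  proof -
    have "z \<noteq> 0" "z \<noteq> 1" using that by (auto simp: dist_norm)
    then show ?thesis unfolding f0 by (simp split: sum.split)
  qed
  obtain U where U: "open U" "v0 \<in> U" "\<And>v. v \<in> U \<Longrightarrow> \<exists>z\<in>ball 1 (1/2). f v z = 0"
    "\<And>v z. v \<in> U \<Longrightarrow> z \<in> sphere 1 (1/2) \<Longrightarrow> f v z \<noteq> 0"
    using persistent_zero[of f "1/2" v0 1, OF cont hol _ root nz] by auto
  \<comment> \<open>\<open>E v\<close> has to stay injective near \<open>v0\<close> for
    \<open>stabilizable_rank_constant\<close> to apply.\<close>
  have ker: "x = 0" if "E v0 *v x = 0" for x
  proof -
    have "(E v0 *v x) $ inv b (Inl j) = x $ j" for j
      using b by (simp add: E0 matrix_vector_mult_def bij_is_surj surj_f_inv_f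
          if_distrib[of "\<lambda>x. x * _"] cong: if_cong)
    then show ?thesis using that by (simp add: vec_eq_iff)
  qed
  have "polynomial_function (\<lambda>v. E v $ i $ j)" for i j
    by (intro polynomial_function_vec_nth poly)
  then obtain p where p: "real_polynomial_function p" "p v0 \<noteq> 0"
    "\<And>v x. p v \<noteq> 0 \<Longrightarrow> map_matrix to_complex (E v) *v x = 0 \<Longrightarrow> x = 0"
    using injective_matrix_polynomial[of E v0, OF _ ker] by blast
  have "open {v. p v \<noteq> 0}"
    using p(1) by (intro open_Collect_neq continuous_on_polymonial_function)
      (simp_all add: real_polynomial_function_eq)
  then have "open (U \<inter> {v. p v \<noteq> 0})" "v0 \<in> U \<inter> {v. p v \<noteq> 0}"
    using U p by auto
  moreover have "(E v, A v, B v) \<notin> behavioural_stabilizable \<union> completely_stabilizable \<union> strongly_stabilizable"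
    if v: "v \<in> U \<inter> {v. p v \<noteq> 0}" for v
  proof
    assume stab: "(E v, A v, B v) \<in> behavioural_stabilizable \<union> completely_stabilizable \<union> strongly_stabilizable"
    have inj: "x = 0" if "E v *v x = 0" for x
      using kernel_of_complexification[of "E v" x] p(3) v that by blast
    obtain z where z: "z \<in> ball 1 (1/2)" "f v z = 0" using U(3) v by blast
    have "Re z \<ge> 0"
      using z(1) abs_Re_le_cmod[of "1 - z"] by (auto simp: dist_norm)
    then have "z \<in> closed_rhp" by (simp add: closed_rhp_def)
    \<comment> \<open>A point of the circle: there \<open>f v\<close> is nonzero and the rank is
      full, whereas it drops at \<open>z\<close>.\<close>
    moreover have "3/2 \<in> closed_rhp" by (simp add: closed_rhp_def)
    ultimately have "rank_pencil_at z (E v) (A v) (B v) = rank_pencil_at (3/2) (E v) (A v) (B v)"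
      using stabilizable_rank_constant[OF stab inj] by blast
    moreover have "f v (3/2) \<noteq> 0"
      using v by (intro U(4)) (auto simp: dist_norm)
    ultimately show False using z(2) kernel by metis
  qed
  ultimately show ?thesis by (rule that)
qed

section \<open>The tall case\<close>

text \<open>A single column of \<open>A\<close> that is independent of the columns of
  \<open>E\<close> and \<open>B\<close> raises the rank of \<open>[E, A, B]\<close> to at least
  \<open>n + m + 1\<close>, while \<open>[zE - A, B]\<close> has only \<open>n + m\<close>
  columns.\<close>

lemma excess_rank_polynomial:
  fixes E A :: "'v::euclidean_space \<Rightarrow> ('k::real_or_complex, 'l::finite, 'n::finite) matrix"
    and B :: "'v \<Rightarrow> ('k, 'l, 'm::finite) matrix" and p0 :: 'n
  assumes poly: "polynomial_function E" "polynomial_function A" "polynomial_function B"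
    and inj: "\<forall>x s y. E v0 *v x + s *s column p0 (A v0) + B v0 *v y = 0 \<longrightarrow> x = 0 \<and> s = 0 \<and> y = 0"
  obtains p where "real_polynomial_function p" "p v0 \<noteq> 0"
    "\<And>v. p v \<noteq> 0 \<Longrightarrow> (E v, A v, B v) \<notin> completely_stabilizable \<union> strongly_stabilizable"
proof -
  define C :: "'v \<Rightarrow> ('k, 'l, 1) matrix" where "C v = (\<chi> i _. A v $ i $ p0)" for v
  define M where "M v = hcat (E v) (hcat (C v) (B v))" for v
  have mul: "M v *v w = E v *v (\<chi> j. w $ Inl j) + w $ Inr (Inl 1) *s column p0 (A v) + B v *v (\<chi> j. w $ Inr (Inr j))"
    for v w
    by (simp add: M_def hcat_mul)
       (simp add: vec_eq_iff C_def matrix_vector_mult_def column_def UNIV_1 mult.commute)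
  have "polynomial_function (\<lambda>v. M v $ r $ c)" for r c
  proof (cases c)
    case (Inl j)
    then show ?thesis by (simp add: M_def hcat_def polynomial_function_vec_nth poly)
  next
    case (Inr c')
    then show ?thesis
      by (cases c') (simp_all add: M_def C_def hcat_def polynomial_function_vec_nth poly)
  qed
  moreover have "w = 0" if "M v0 *v w = 0" for w
  proof -
    have "(\<chi> j. w $ Inl j) = 0" "w $ Inr (Inl 1) = 0" "(\<chi> j. w $ Inr (Inr j)) = 0"
      using inj that unfolding mul by blast+
    then show ?thesis by (simp add: vec_eq_iff split_sum_all forall_1)
  qed
  ultimately obtain p where p: "real_polynomial_function p" "p v0 \<noteq> 0"
    "\<And>v x. p v \<noteq> 0 \<Longrightarrow> map_matrix to_complex (M v) *v x = 0 \<Longrightarrow> x = 0"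
    using injective_matrix_polynomial[of M v0] by blast
  have "(E v, A v, B v) \<notin> completely_stabilizable \<union> strongly_stabilizable" if v: "p v \<noteq> 0" for v
  proof
    assume stab: "(E v, A v, B v) \<in> completely_stabilizable \<union> strongly_stabilizable"
    have kerM: "w = 0" if "M v *v w = 0" for w
      using kernel_of_complexification[of "M v" w] p(3) v that by blast
    have inj: "x = 0" if "E v *v x = 0" for x
    proof -
      have "M v *v (\<chi> c. case c of Inl j \<Rightarrow> x $ j | Inr _ \<Rightarrow> 0) = 0"
        using that by (simp add: mul) (simp add: matrix_vector_mult_def vec_eq_iff)
      then have "(\<chi> c. case c of Inl j \<Rightarrow> x $ j | Inr _ \<Rightarrow> 0) = (0 :: 'k ^ ('n + (1 + 'm)))"
        by (rule kerM)
      then show ?thesis by (simp add: vec_eq_iff split_sum_all)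
    qed
    have "0 \<in> closed_rhp" by (simp add: closed_rhp_def)
    then have "rank (hcat (E v) (hcat (A v) (B v))) = rank_pencil_at 0 (E v) (A v) (B v)"
      using stab strongly_stabilizable_rank[OF _ inj]
      unfolding completely_stabilizable_def by fastforce
    also have "\<dots> \<le> CARD('n + 'm)"
      unfolding rank_pencil_at_eq by (rule rank_le_card_columns)
    finally have "rank (hcat (E v) (hcat (A v) (B v))) \<le> CARD('n) + CARD('m)" by simp
    moreover have "rank (M v) = CARD('n + (1 + 'm))"
      unfolding rank_eq_card_columns_iff using kerM by blast
    moreover have "rank (M v) \<le> rank (hcat (E v) (hcat (A v) (B v)))"
    proof -
      \<comment> \<open>Selects the columns of \<open>M v\<close> from those of
        \<open>[E, A, B]\<close>.\<close>
      define G :: "('k, 'n + ('n + 'm), 'n + (1 + 'm)) matrix" where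
        "G = (\<chi> i j. case j of Inl p \<Rightarrow> if i = Inl p then 1 else 0
          | Inr (Inl _) \<Rightarrow> if i = Inr (Inl p0) then 1 else 0
          | Inr (Inr q) \<Rightarrow> if i = Inr (Inr q) then 1 else 0)"
      have "M v = hcat (E v) (hcat (A v) (B v)) ** G"
        by (simp add: vec_eq_iff matrix_matrix_mult_def M_def C_def G_def hcat_def
            if_distrib[of "\<lambda>x. _ * x"] cong: if_cong split: sum.split)
      then show ?thesis by (metis rank_mult_le_left)
    qed
    ultimately show False by simp
  qed
  with p(1,2) that show ?thesis by blast
qed

lemma excess_witness:
  assumes "CARD('n::finite) + CARD('m::finite) < CARD('l::finite)"
  obtains E :: "('k::real_or_complex, 'l::finite, 'n::finite) matrix" and J
    and B :: "('k, 'l, 'm::finite) matrix" and p0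
  where "J = - adj J"
    "\<forall>x s y. E *v x + s *s column p0 (J ** E) + B *v y = 0 \<longrightarrow> x = 0 \<and> s = 0 \<and> y = 0"
    "\<forall>x s y. E *v x + s *s column p0 ((J - mat 1) ** E) + B *v y = 0 \<longrightarrow> x = 0 \<and> s = 0 \<and> y = 0"
proof -
  have "CARD('n + 'm) \<le> CARD('l)" using assms by simp
  then obtain h :: "'n + 'm \<Rightarrow> 'l" where h: "inj h"
    using card_le_inj[of "UNIV :: ('n + 'm) set" "UNIV :: 'l set"] by auto
  have "range h \<noteq> UNIV"
  proof
    assume "range h = UNIV"
    then have "CARD('l) = CARD('n + 'm)" using card_image[OF h] by simp
    then show False using assms by simp
  qed
  then obtain i0 where i0: "\<And>c. h c \<noteq> i0"
    unfolding surj_def by metis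
  define p0 :: 'n where "p0 = undefined"
  define E :: "('k, 'l, 'n) matrix" where "E = (\<chi> i j. if i = h (Inl j) then 1 else 0)"
  define B :: "('k, 'l, 'm) matrix" where "B = (\<chi> i j. if i = h (Inr j) then 1 else 0)"
  \<comment> \<open>\<open>J\<close> sends the unit vector of row \<open>h (Inl p0)\<close> to that
    of the unoccupied row \<open>i0\<close>, so column \<open>p0\<close> of \<open>J ** E\<close>
    leaves the span of the columns of \<open>E\<close> and \<open>B\<close>.\<close>
  define J :: "('k, 'l, 'l) matrix" where
    "J = (\<chi> i j. if i = i0 \<and> j = h (Inl p0) then 1 else if i = h (Inl p0) \<and> j = i0 then -1 else 0)"
  have "adj J = - J"
    using i0[of "Inl p0"] by (simp add: adj_def J_def vec_eq_iff)
  then have J: "J = - adj J" by (rule skew_iff[THEN iffD2])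
  \<comment> \<open>A diagonal \<open>R\<close> contributes nothing to row \<open>i0\<close> of the
    equation, which therefore still isolates \<open>s\<close>. Both \<open>R = 0\<close> and
    \<open>R = mat 1\<close> are of this kind.\<close>
  have indep: "x = 0 \<and> s = 0 \<and> y = 0"
    if R: "\<And>i j. i \<noteq> j \<Longrightarrow> R $ i $ j = 0"
      and eq: "E *v x + s *s column p0 ((J - R) ** E) + B *v y = 0" for R x s y
  proof -
    have col: "column p0 ((J - R) ** E) $ i = (J - R) $ i $ h (Inl p0)" for i
      by (simp add: column_def matrix_matrix_mult_def E_def if_distrib[of "\<lambda>x. _ * x"] cong: if_cong)
    have Ex: "(E *v x) $ i = (\<Sum>j\<in>UNIV. if i = h (Inl j) then x $ j else 0)"
      and By: "(B *v y) $ i = (\<Sum>j\<in>UNIV. if i = h (Inr j) then y $ j else 0)" for i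
      by (simp_all add: matrix_vector_mult_def E_def B_def if_distrib[of "\<lambda>x. x * _"] cong: if_cong)
    have eq_i: "(E *v x) $ i + s * (J - R) $ i $ h (Inl p0) + (B *v y) $ i = 0" for i
      using arg_cong[OF eq, of "\<lambda>v. v $ i"] by (simp add: col)
    have "s = 0"
      using eq_i[of i0] i0[symmetric] R[of i0 "h (Inl p0)"] by (simp add: Ex By J_def)
    then have eq_0: "(E *v x) $ i + (B *v y) $ i = 0" for i
      using eq_i by simp
    have "x $ j = 0" for j
      using eq_0[of "h (Inl j)"] by (simp add: Ex By inj_eq[OF h])
    moreover have "y $ j = 0" for j
      using eq_0[of "h (Inr j)"] by (simp add: Ex By inj_eq[OF h])
    ultimately show ?thesis using \<open>s = 0\<close> by (simp add: vec_eq_iff)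
  qed
  have "\<forall>x s y. E *v x + s *s column p0 (J ** E) + B *v y = 0 \<longrightarrow> x = 0 \<and> s = 0 \<and> y = 0"
    using indep[of 0] by simp
  moreover have "\<forall>x s y. E *v x + s *s column p0 ((J - mat 1) ** E) + B *v y = 0 \<longrightarrow> x = 0 \<and> s = 0 \<and> y = 0"
    using indep[of "mat 1"] by (simp add: mat_def)
  ultimately show ?thesis by (rule that[OF J])
qed

text \<open>\<open>Q\<close> maps into a row of \<open>B\<close>, where \<open>E\<close> vanishes,
  so \<open>adj E ** Q = 0\<close> is semidefinite for free, and \<open>J\<close> leads back to a
  row of \<open>E\<close>. This detour yields the entry 1 of \<open>J ** Q\<close>; with
  \<open>Q = E\<close> it would be a diagonal entry of the skew \<open>J\<close>, which is never
  1.\<close>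

lemma square_witness:
  assumes "CARD('l::finite) = CARD('n::finite) + CARD('m::finite)"
  obtains E Q :: "('k::real_or_complex, 'l::finite, 'n::finite) matrix" and J
    and B :: "('k, 'l, 'm::finite) matrix" and b :: "'l \<Rightarrow> 'n + 'm" and p0
  where "J = - adj J" "adj E ** Q = 0" "adj Q ** E = 0" "bij b"
    "E = (\<chi> i j. if b i = Inl j then 1 else 0)"
    "J ** Q = (\<chi> i j. if b i = Inl p0 \<and> j = p0 then 1 else 0)"
    "B = (\<chi> i j. if b i = Inr j then 1 else 0)"
proof -
  have "CARD('l) = CARD('n + 'm)" using assms by simp
  then obtain b :: "'l \<Rightarrow> 'n + 'm" where b: "bij b"
    using finite_same_card_bij[of "UNIV :: 'l set" "UNIV :: ('n + 'm) set"] by auto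
  define p0 :: 'n where "p0 = undefined"
  define q0 :: 'm where "q0 = undefined"
  define E :: "('k, 'l, 'n) matrix" where "E = (\<chi> i j. if b i = Inl j then 1 else 0)"
  define Q :: "('k, 'l, 'n) matrix" where "Q = (\<chi> i j. if b i = Inr q0 \<and> j = p0 then 1 else 0)"
  define B :: "('k, 'l, 'm) matrix" where "B = (\<chi> i j. if b i = Inr j then 1 else 0)"
  define J :: "('k, 'l, 'l) matrix" where "J = (\<chi> i j. if b i = Inl p0 \<and> b j = Inr q0 then 1
    else if b i = Inr q0 \<and> b j = Inl p0 then -1 else 0)"
  have "adj J = - J"
    by (simp add: adj_def J_def vec_eq_iff)
  then have "J = - adj J" by (rule skew_iff[THEN iffD2])
  moreover have EQ: "adj E ** Q = 0"
    by (auto simp: adj_def E_def Q_def vec_eq_iff matrix_matrix_mult_def intro!: sum.neutral)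
  moreover have "adj Q ** E = 0"
    by (auto simp: adj_def E_def Q_def vec_eq_iff matrix_matrix_mult_def intro!: sum.neutral)
  moreover have "J ** Q = (\<chi> i j. if b i = Inl p0 \<and> j = p0 then 1 else 0)"
  proof -
    have "b k = Inr q0 \<longleftrightarrow> k = inv b (Inr q0)" for k
      using b by (metis bij_inv_eq_iff)
    then have "(J ** Q) $ i $ j = (if j = p0 then J $ i $ inv b (Inr q0) else 0)" for i j
      by (simp add: matrix_matrix_mult_def Q_def if_distrib[of "\<lambda>x. _ * x"] cong: if_cong)
    moreover have "J $ i $ inv b (Inr q0) = (if b i = Inl p0 then 1 else 0)" for i
      using b by (simp add: J_def bij_is_surj surj_f_inv_f)
    ultimately show ?thesis by (simp add: vec_eq_iff)
  qed
  ultimately show ?thesis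
    using that[of J E Q b p0 B] b E_def B_def by blast
qed

section \<open>Genericity of the stabilizability properties\<close>

text \<open>The complement of an algebraic set is open, so genericity of \<open>- S\<close> produces
  a nonempty relatively open part of \<open>V\<close> that avoids \<open>S\<close>.\<close>

lemma relative_generic_Compl_imp_not:
  assumes "relative_generic (- S) V" "V \<noteq> {}"
  shows "\<not> relative_generic S V"
proof -
  obtain W where W: "algebraic_set W" "S \<inter> V \<subseteq> W \<inter> V" "V \<subseteq> closure (- W \<inter> V)"
    using assms(1) unfolding relative_generic_def by auto
  obtain P where P: "\<forall>p\<in>P. real_polynomial_function p" "W = {x. \<forall>p\<in>P. p x = 0}"
    using W(1) unfolding algebraic_set_def by blast
  have "W = (\<Inter>p\<in>P. {x. p x = 0})" using P(2) by blast
  moreover have "closed {x. p x = 0}" if "p \<in> P" for p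
    using P(1) that
    by (intro closed_Collect_eq continuous_on_const continuous_on_polymonial_function)
       (simp add: real_polynomial_function_eq)
  ultimately have "open (- W)" by (auto simp: closed_def[symmetric])
  moreover have "- W \<inter> V \<noteq> {}" using W(3) assms(2) by auto
  ultimately show ?thesis
    using not_relative_genericI[of "- W" _ V S] W(2) by blast
qed

lemma S_H_iff: "v \<in> S_H T \<longleftrightarrow>
    v \<in> Sigma_H \<and> (fst v, fst (snd v) ** fst (snd (snd v)), snd (snd (snd v))) \<in> T"
  by (cases v) (simp add: S_H_def)

lemma S_sdH_iff: "v \<in> S_sdH T \<longleftrightarrow> v \<in> Sigma_sdH \<and>
    (fst v, (fst (snd v) - fst (snd (snd v))) ** fst (snd (snd (snd v))), snd (snd (snd (snd v)))) \<in> T"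
  by (cases v) (simp add: S_sdH_def)

lemma S_dH_iff: "v \<in> S_dH T \<longleftrightarrow> v \<in> Sigma_dH \<and>
    (fst v, (fst (snd v) - fst (snd (snd v))) ** fst (snd (snd (snd v))), snd (snd (snd (snd v)))) \<in> T"
  by (cases v) (simp add: S_dH_def)

lemma adj_0: "adj 0 = 0"
  by (simp add: adj_def vec_eq_iff)

lemma zero_in_Sigma_H: "0 \<in> Sigma_H"
  and zero_in_Sigma_sdH: "0 \<in> Sigma_sdH"
  by (simp_all add: Sigma_H_def Sigma_sdH_def zero_prod_def psd_0 adj_0)

lemma polynomial_function_ham:
  "polynomial_function (\<lambda>v :: ('k::real_or_complex, 'l::finite, 'n::finite, 'm::finite) ham. fst v)"
  "polynomial_function (\<lambda>v :: ('k, 'l, 'n, 'm) ham. fst (snd v) ** fst (snd (snd v)))"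
  "polynomial_function (\<lambda>v :: ('k, 'l, 'n, 'm) ham. snd (snd (snd v)))"
  by (intro polynomial_function_matrix_mult polynomial_function_projections)+

lemma polynomial_function_diss_ham:
  "polynomial_function (\<lambda>v :: ('k::real_or_complex, 'l::finite, 'n::finite, 'm::finite) diss_ham. fst v)"
  "polynomial_function (\<lambda>v :: ('k, 'l, 'n, 'm) diss_ham.
     (fst (snd v) - fst (snd (snd v))) ** fst (snd (snd (snd v))))"
  "polynomial_function (\<lambda>v :: ('k, 'l, 'n, 'm) diss_ham. snd (snd (snd (snd v))))"
  by (intro polynomial_function_matrix_mult polynomial_function_diff polynomial_function_projections)+

text \<open>One polynomial serves the three properties simultaneously, hence any \<open>T\<close>
  that contains their intersection.\<close>

lemma wide_generic_H:
  assumes "CARD('l) < CARD('n) + CARD('m)"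
    and T: "behavioural_stabilizable \<inter> completely_stabilizable \<inter> strongly_stabilizable \<subseteq> T"
  shows "relative_generic (S_H T) (Sigma_H :: ('k::real_or_complex, 'l::finite, 'n::finite, 'm::finite) ham set)"
proof -
  obtain E :: "('k, 'l, 'n) matrix" and J and B :: "('k, 'l, 'm) matrix" where J: "J = - adj J" and
    rec: "wide_determined E (J ** E) B"
    by (rule wide_witness[OF assms(1)]) (rule that)
  obtain p where p: "real_polynomial_function p" "p (E, J, E, B) \<noteq> 0"
    "\<And>v. p v \<noteq> 0 \<Longrightarrow> (fst v, fst (snd v) ** fst (snd (snd v)), snd (snd (snd v)))
      \<in> behavioural_stabilizable \<inter> completely_stabilizable \<inter> strongly_stabilizable"
    by (rule wide_recurrence_polynomial[OF polynomial_function_ham, of "(E, J, E, B)",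
        unfolded fst_conv snd_conv, OF rec]) (rule that)
  show ?thesis
    using p(1) dense_nonzero_Sigma_H[OF p(1,2) J]
    by (rule relative_genericI) (use p(3) T in \<open>unfold S_H_iff, blast\<close>)
qed

lemma wide_generic_sdH:
  assumes "CARD('l) < CARD('n) + CARD('m)"
    and T: "behavioural_stabilizable \<inter> completely_stabilizable \<inter> strongly_stabilizable \<subseteq> T"
  shows "relative_generic (S_sdH T)
    (Sigma_sdH :: ('k::real_or_complex, 'l::finite, 'n::finite, 'm::finite) diss_ham set)"
proof -
  obtain E :: "('k, 'l, 'n) matrix" and J and B :: "('k, 'l, 'm) matrix" where J: "J = - adj J" and
    rec: "wide_determined E (J ** E) B"
    by (rule wide_witness[OF assms(1)]) (rule that)
  \<comment> \<open>\<open>R = 0\<close> is semidefinite, so the witness without dissipation carries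
    over.\<close>
  obtain p where p: "real_polynomial_function p" "p (E, J, 0, E, B) \<noteq> 0"
    "\<And>v. p v \<noteq> 0 \<Longrightarrow>
      (fst v, (fst (snd v) - fst (snd (snd v))) ** fst (snd (snd (snd v))), snd (snd (snd (snd v))))
      \<in> behavioural_stabilizable \<inter> completely_stabilizable \<inter> strongly_stabilizable"
    by (rule wide_recurrence_polynomial[OF polynomial_function_diss_ham, of "(E, J, 0, E, B)",
        unfolded fst_conv snd_conv diff_zero, OF rec]) (rule that)
  show ?thesis
    using p(1) dense_nonzero_Sigma_sdH[OF p(1,2) J psd_0]
    by (rule relative_genericI) (use p(3) T in \<open>unfold S_sdH_iff, blast\<close>)
qed

lemma tall_generic_H:
  assumes "CARD('n) + CARD('m) < CARD('l)"
  shows "relative_generic (S_H behavioural_stabilizable)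
    (Sigma_H :: ('k::real_or_complex, 'l::finite, 'n::finite, 'm::finite) ham set)"
proof -
  obtain E :: "('k, 'l, 'n) matrix" and J and B :: "('k, 'l, 'm) matrix" where J: "J = - adj J" and
    rec: "tall_determined E (J ** E) B"
    by (rule tall_witness[OF assms]) (rule that)
  have card: "1 < CARD('l)"
    using assms zero_less_card_finite[where 'a='n] by linarith
  obtain p where p: "real_polynomial_function p" "p (E, J, E, B) \<noteq> 0"
    "\<And>v. p v \<noteq> 0 \<Longrightarrow> (fst v, fst (snd v) ** fst (snd (snd v)), snd (snd (snd v)))
      \<in> behavioural_stabilizable"
    by (rule tall_recurrence_polynomial[OF polynomial_function_ham card, of "(E, J, E, B)",
        unfolded fst_conv snd_conv, OF rec]) (rule that)
  show ?thesis
    using p(1) dense_nonzero_Sigma_H[OF p(1,2) J]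
    by (rule relative_genericI) (use p(3) in \<open>unfold S_H_iff, blast\<close>)
qed

lemma tall_generic_sdH:
  assumes "CARD('n) + CARD('m) < CARD('l)"
  shows "relative_generic (S_sdH behavioural_stabilizable)
    (Sigma_sdH :: ('k::real_or_complex, 'l::finite, 'n::finite, 'm::finite) diss_ham set)"
proof -
  obtain E :: "('k, 'l, 'n) matrix" and J and B :: "('k, 'l, 'm) matrix" where J: "J = - adj J" and
    rec: "tall_determined E (J ** E) B"
    by (rule tall_witness[OF assms]) (rule that)
  have card: "1 < CARD('l)"
    using assms zero_less_card_finite[where 'a='n] by linarith
  obtain p where p: "real_polynomial_function p" "p (E, J, 0, E, B) \<noteq> 0"
    "\<And>v. p v \<noteq> 0 \<Longrightarrow>
      (fst v, (fst (snd v) - fst (snd (snd v))) ** fst (snd (snd (snd v))), snd (snd (snd (snd v))))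
      \<in> behavioural_stabilizable"
    by (rule tall_recurrence_polynomial[OF polynomial_function_diss_ham card, of "(E, J, 0, E, B)",
        unfolded fst_conv snd_conv diff_zero, OF rec]) (rule that)
  show ?thesis
    using p(1) dense_nonzero_Sigma_sdH[OF p(1,2) J psd_0]
    by (rule relative_genericI) (use p(3) in \<open>unfold S_sdH_iff, blast\<close>)
qed

lemma tall_generic_Compl_H:
  assumes "CARD('n) + CARD('m) < CARD('l)"
    and T: "T \<subseteq> completely_stabilizable \<union> strongly_stabilizable"
  shows "relative_generic (- S_H T)
    (Sigma_H :: ('k::real_or_complex, 'l::finite, 'n::finite, 'm::finite) ham set)"
proof -
  obtain E :: "('k, 'l, 'n) matrix" and J and B :: "('k, 'l, 'm) matrix" and p0
    where J: "J = - adj J" and indep: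
      "\<forall>x s y. E *v x + s *s column p0 (J ** E) + B *v y = 0 \<longrightarrow> x = 0 \<and> s = 0 \<and> y = 0"
      "\<forall>x s y. E *v x + s *s column p0 ((J - mat 1) ** E) + B *v y = 0 \<longrightarrow> x = 0 \<and> s = 0 \<and> y = 0"
    by (rule excess_witness[OF assms(1)]) (rule that)
  obtain p where p: "real_polynomial_function p" "p (E, J, E, B) \<noteq> 0"
    "\<And>v. p v \<noteq> 0 \<Longrightarrow> (fst v, fst (snd v) ** fst (snd (snd v)), snd (snd (snd v)))
      \<notin> completely_stabilizable \<union> strongly_stabilizable"
    by (rule excess_rank_polynomial[OF polynomial_function_ham, of "(E, J, E, B)" p0,
        unfolded fst_conv snd_conv, OF indep(1)]) (rule that)
  show ?thesis
    using p(1) dense_nonzero_Sigma_H[OF p(1,2) J]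
    by (rule relative_genericI) (use p(3) T in \<open>unfold Compl_iff S_H_iff, blast\<close>)
qed

lemma tall_generic_Compl_diss:
  assumes "CARD('n) + CARD('m) < CARD('l)"
    and T: "T \<subseteq> completely_stabilizable \<union> strongly_stabilizable"
  shows "relative_generic (- S_sdH T)
      (Sigma_sdH :: ('k::real_or_complex, 'l::finite, 'n::finite, 'm::finite) diss_ham set)"
    and "relative_generic (- S_dH T) (Sigma_dH :: ('k, 'l, 'n, 'm) diss_ham set)"
proof -
  obtain E :: "('k, 'l, 'n) matrix" and J and B :: "('k, 'l, 'm) matrix" and p0
    where J: "J = - adj J" and indep:
      "\<forall>x s y. E *v x + s *s column p0 (J ** E) + B *v y = 0 \<longrightarrow> x = 0 \<and> s = 0 \<and> y = 0"
      "\<forall>x s y. E *v x + s *s column p0 ((J - mat 1) ** E) + B *v y = 0 \<longrightarrow> x = 0 \<and> s = 0 \<and> y = 0"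
    by (rule excess_witness[OF assms(1)]) (rule that)
  \<comment> \<open>\<open>R = mat 1\<close> is definite and thus lies in both cones, so a single
    polynomial serves both reference sets.\<close>
  obtain p where p: "real_polynomial_function p" "p (E, J, mat 1, E, B) \<noteq> 0"
    "\<And>v. p v \<noteq> 0 \<Longrightarrow>
      (fst v, (fst (snd v) - fst (snd (snd v))) ** fst (snd (snd (snd v))), snd (snd (snd (snd v))))
      \<notin> completely_stabilizable \<union> strongly_stabilizable"
    by (rule excess_rank_polynomial[OF polynomial_function_diss_ham, of "(E, J, mat 1, E, B)" p0,
        unfolded fst_conv snd_conv, OF indep(2)]) (rule that)
  show "relative_generic (- S_sdH T) (Sigma_sdH :: ('k, 'l, 'n, 'm) diss_ham set)"
    using p(1) dense_nonzero_Sigma_sdH[OF p(1,2) J pd_imp_psd[OF pd_mat_1]]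
    by (rule relative_genericI) (use p(3) T in \<open>unfold Compl_iff S_sdH_iff, blast\<close>)
  show "relative_generic (- S_dH T) (Sigma_dH :: ('k, 'l, 'n, 'm) diss_ham set)"
    using p(1) dense_nonzero_Sigma_dH[OF p(1,2) J pd_mat_1]
    by (rule relative_genericI) (use p(3) T in \<open>unfold Compl_iff S_dH_iff, blast\<close>)
qed

lemma square_not_generic_H:
  assumes "CARD('l) = CARD('n) + CARD('m)"
    and T: "T \<subseteq> behavioural_stabilizable \<union> completely_stabilizable \<union> strongly_stabilizable"
  shows "\<not> relative_generic (S_H T)
    (Sigma_H :: ('k::real_or_complex, 'l::finite, 'n::finite, 'm::finite) ham set)"
proof -
  obtain E Q :: "('k, 'l, 'n) matrix" and J and B :: "('k, 'l, 'm) matrix" and b :: "'l \<Rightarrow> 'n + 'm" and p0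
    where w: "J = - adj J" "adj E ** Q = 0" "adj Q ** E = 0" "bij b"
    "E = (\<chi> i j. if b i = Inl j then 1 else 0)"
    "J ** Q = (\<chi> i j. if b i = Inl p0 \<and> j = p0 then 1 else 0)"
    "B = (\<chi> i j. if b i = Inr j then 1 else 0)"
    by (rule square_witness[OF assms(1)]) (rule that)
  obtain U where U: "open U" "(E, J, Q, B) \<in> U"
    "\<And>v. v \<in> U \<Longrightarrow> (fst v, fst (snd v) ** fst (snd (snd v)), snd (snd (snd v)))
      \<notin> behavioural_stabilizable \<union> completely_stabilizable \<union> strongly_stabilizable"
    by (rule square_rank_drop[OF polynomial_function_ham w(4), of "(E, J, Q, B)" p0,
        unfolded fst_conv snd_conv, OF w(5-7)]) (rule that)
  have "(E, J, Q, B) \<in> Sigma_H"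
    unfolding Sigma_H_def mem_Collect_eq prod.case w(2,3) by (intro conjI refl psd_0 w(1))
  with U(1,2) show ?thesis
    by (rule not_relative_genericI) (use U(3) T in \<open>unfold set_eq_iff Int_iff S_H_iff, blast\<close>)
qed

lemma square_not_generic_sdH:
  assumes "CARD('l) = CARD('n) + CARD('m)"
    and T: "T \<subseteq> behavioural_stabilizable \<union> completely_stabilizable \<union> strongly_stabilizable"
  shows "\<not> relative_generic (S_sdH T)
    (Sigma_sdH :: ('k::real_or_complex, 'l::finite, 'n::finite, 'm::finite) diss_ham set)"
proof -
  obtain E Q :: "('k, 'l, 'n) matrix" and J and B :: "('k, 'l, 'm) matrix" and b :: "'l \<Rightarrow> 'n + 'm" and p0
    where w: "J = - adj J" "adj E ** Q = 0" "adj Q ** E = 0" "bij b"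
    "E = (\<chi> i j. if b i = Inl j then 1 else 0)"
    "J ** Q = (\<chi> i j. if b i = Inl p0 \<and> j = p0 then 1 else 0)"
    "B = (\<chi> i j. if b i = Inr j then 1 else 0)"
    by (rule square_witness[OF assms(1)]) (rule that)
  obtain U where U: "open U" "(E, J, 0, Q, B) \<in> U"
    "\<And>v. v \<in> U \<Longrightarrow>
      (fst v, (fst (snd v) - fst (snd (snd v))) ** fst (snd (snd (snd v))), snd (snd (snd (snd v))))
      \<notin> behavioural_stabilizable \<union> completely_stabilizable \<union> strongly_stabilizable"
    by (rule square_rank_drop[OF polynomial_function_diss_ham w(4), of "(E, J, 0, Q, B)" p0,
        unfolded fst_conv snd_conv diff_zero, OF w(5-7)]) (rule that)
  have "(E, J, 0, Q, B) \<in> Sigma_sdH"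
    unfolding Sigma_sdH_def mem_Collect_eq prod.case w(2,3)
    by (intro conjI refl psd_0 sym[OF psd_adj] w(1))
  with U(1,2) show ?thesis
    by (rule not_relative_genericI) (use U(3) T in \<open>unfold set_eq_iff Int_iff S_sdH_iff, blast\<close>)
qed

theorem theorem5p1:
  shows
   "(relative_generic
        (S_H behavioural_stabilizable)
        (Sigma_H :: ('k::real_or_complex, 'l::finite, 'n::finite, 'm::finite) ham set)
      \<longleftrightarrow> CARD('l) \<noteq> CARD('n) + CARD('m)) \<and>
    (relative_generic
        (S_H completely_stabilizable) (Sigma_H :: ('k, 'l, 'n, 'm) ham set)
      \<longleftrightarrow> CARD('l) < CARD('n) + CARD('m)) \<and>
    (relative_generic
        (S_H strongly_stabilizable) (Sigma_H :: ('k, 'l, 'n, 'm) ham set)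
      \<longleftrightarrow> CARD('l) < CARD('n) + CARD('m)) \<and>
    (relative_generic
        (S_sdH behavioural_stabilizable) (Sigma_sdH :: ('k, 'l, 'n, 'm) diss_ham set)
      \<longleftrightarrow> CARD('l) \<noteq> CARD('n) + CARD('m)) \<and>
    (relative_generic
        (S_sdH completely_stabilizable) (Sigma_sdH :: ('k, 'l, 'n, 'm) diss_ham set)
      \<longleftrightarrow> CARD('l) < CARD('n) + CARD('m)) \<and>
    (relative_generic
        (S_sdH strongly_stabilizable) (Sigma_sdH :: ('k, 'l, 'n, 'm) diss_ham set)
      \<longleftrightarrow> CARD('l) < CARD('n) + CARD('m)) \<and>
    (CARD('l) > CARD('n) + CARD('m) \<longrightarrow>
      relative_generic
        (- S_H completely_stabilizable) (Sigma_H :: ('k, 'l, 'n, 'm) ham set) \<and>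
      relative_generic
        (- S_H strongly_stabilizable) (Sigma_H :: ('k, 'l, 'n, 'm) ham set) \<and>
      relative_generic
        (- S_dH completely_stabilizable) (Sigma_dH :: ('k, 'l, 'n, 'm) diss_ham set) \<and>
      relative_generic
        (- S_dH strongly_stabilizable) (Sigma_dH :: ('k, 'l, 'n, 'm) diss_ham set))"
proof -
  have nonempty: "(Sigma_H :: ('k, 'l, 'n, 'm) ham set) \<noteq> {}"
    "(Sigma_sdH :: ('k, 'l, 'n, 'm) diss_ham set) \<noteq> {}"
    using zero_in_Sigma_H zero_in_Sigma_sdH by blast+
  consider "CARD('l) < CARD('n) + CARD('m)" | "CARD('l) = CARD('n) + CARD('m)"
    | "CARD('n) + CARD('m) < CARD('l)" by linarith
  then show ?thesis
  proof cases
    case 1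
    then have "relative_generic (S_H T) (Sigma_H :: ('k, 'l, 'n, 'm) ham set)"
        "relative_generic (S_sdH T) (Sigma_sdH :: ('k, 'l, 'n, 'm) diss_ham set)"
      if "T \<in> {behavioural_stabilizable, completely_stabilizable, strongly_stabilizable}" for T
      using wide_generic_H[of T] wide_generic_sdH[of T] that by blast+
    with 1 show ?thesis by simp
  next
    case 2
    then have "\<not> relative_generic (S_H T) (Sigma_H :: ('k, 'l, 'n, 'm) ham set)"
        "\<not> relative_generic (S_sdH T) (Sigma_sdH :: ('k, 'l, 'n, 'm) diss_ham set)"
      if "T \<in> {behavioural_stabilizable, completely_stabilizable, strongly_stabilizable}" for T
      using square_not_generic_H[of T] square_not_generic_sdH[of T] that by blast+
    with 2 show ?thesis by simp
  next
    case 3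
    have compl: "relative_generic (- S_H T) (Sigma_H :: ('k, 'l, 'n, 'm) ham set)"
        "relative_generic (- S_sdH T) (Sigma_sdH :: ('k, 'l, 'n, 'm) diss_ham set)"
        "relative_generic (- S_dH T) (Sigma_dH :: ('k, 'l, 'n, 'm) diss_ham set)"
      if "T \<in> {completely_stabilizable, strongly_stabilizable}" for T
      using tall_generic_Compl_H[OF 3, of T] tall_generic_Compl_diss[OF 3, of T] that by blast+
    have "\<not> relative_generic (S_H T) (Sigma_H :: ('k, 'l, 'n, 'm) ham set)"
        "\<not> relative_generic (S_sdH T) (Sigma_sdH :: ('k, 'l, 'n, 'm) diss_ham set)"
      if "T \<in> {completely_stabilizable, strongly_stabilizable}" for T
      by (rule relative_generic_Compl_imp_not[OF compl(1)[OF that] nonempty(1)],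
          rule relative_generic_Compl_imp_not[OF compl(2)[OF that] nonempty(2)])
    with 3 compl tall_generic_H[OF 3] tall_generic_sdH[OF 3] show ?thesis by simp
  qed
qed

end
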